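(* Let $\varphi:\mathbb{R}^n\to\overline{\mathbb{R}}$ be finite at $\bar x\in\mathbb{R}^n$ and have the composite representation $\varphi=g\circ\Phi$ around $\bar x$. Let $\bar v\in\partial\varphi(\bar x)$ and $\bar\lambda\in\Lambda(\bar x,\bar v)$. If the second-order qualification condition (SOQC) holds at $(\bar x,\bar\lambda)$, then the following properties are equivalent: (a) there exists a neighborhood $U$ of $(\bar x,\bar v)$ such that for any $(x,v)\in U\cap\mathrm{gph}\,\partial\varphi$, the subgradient mapping $\partial\varphi$ is strictly proto-differentiable at $x$ for $v$; (b) $\bar v\in\mathrm{ri}\,\partial\varphi(\bar x)$.
   Context: $\overline{\mathbb{R}}=[-\infty,\infty]$; $\mathrm{ri}$ denotes relative interior. "$\varphi$ has the composite representation around $\bar x$" means: there are a neighborhood $O$ of $\bar x$, a mapping $\Phi:\mathbb{R}^n\to\mathbb{R}^m$ twice continuously differentiable around $\bar x$, and a polyhedral function $g:\mathbb{R}^m\to\overline{\mathbb{R}}$ (proper, with $\mathrm{epi}\,g$ a polyhedral convex set) such that $\varphi(x)=g(\Phi(x))$ for all $x\in O$. $\nabla\Phi(x)$ is the Jacobian and $\nabla\Phi(x)^*$ its transpose. Tangent cone: $T_\Omega(\bar x)=\limsup_{t\searrow0}(\Omega-\bar x)/t$. Regular normal cone: $\widehat N_\Omega(\bar x)=T_\Omega(\bar x)^*$ (polar cone). Limiting normal cone $N_\Omega(\bar x)$: all limits of $v^k\in\widehat N_\Omega(x^k)$ with $x^k\to\bar x$, $x^k\in\Omega$. Subdifferential: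 $\partial f(\bar x)=\{v : (v,-1)\in N_{\mathrm{epi} f}(\bar x,f(\bar x))\}$. Coderivative of $F$: $w\in D^*F(\bar x,\bar y)(u)\iff(w,-u)\in N_{\mathrm{gph}F}(\bar x,\bar y)$. Multipliers: $\Lambda(x,v)=\{\lambda\in\mathbb{R}^m : \nabla\Phi(x)^*\lambda=v,\ \lambda\in\partial g(\Phi(x))\}$. SOQC at $(\bar x,\bar\lambda)$: $D^*(\partial g)(\Phi(\bar x),\bar\lambda)(0)\cap\ker\nabla\Phi(\bar x)^*=\{0\}$. Strict proto-differentiability: a set-valued mapping $F:\mathbb{R}^n\rightrightarrows\mathbb{R}^m$ is strictly proto-differentiable at $\bar x$ for $\bar y\in F(\bar x)$ if the sets $(\mathrm{gph}F-(x,y))/t$ have a full limit (outer limit = inner limit) as $t\searrow0$ and $(x,y)\to(\bar x,\bar y)$ with $(x,y)\in\mathrm{gph}F$. Equivalently, the regular (Clarke) tangent cone (the inner limit) and the paratingent cone (the outer limit) to $\mathrm{gph}F$ at $(\bar x,\bar y)$ coincide. *)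

theory Defs
  imports "HOL-Analysis.Analysis"
begin

section \<open>Set limits\<close>

text \<open>
  Painleve--Kuratowski outer and inner limits of the sets \<open>S p\<close> as \<open>p\<close> runs along a filter.
  The filter carries the mode of convergence, e.g. \<open>at_right 0\<close> for \<open>t \<searrow> 0\<close>.
\<close>

definition outer_limit :: "('p \<Rightarrow> 'a::topological_space set) \<Rightarrow> 'p filter \<Rightarrow> 'a set" where
  "outer_limit S F =
     {w. \<exists>p q. filterlim p F sequentially \<and> (\<forall>\<^sub>F k in sequentially. q k \<in> S (p k)) \<and>
           q \<longlonglongrightarrow> w}"

definition inner_limit :: "('p \<Rightarrow> 'a::topological_space set) \<Rightarrow> 'p filter \<Rightarrow> 'a set" where
  "inner_limit S F =
     {w. \<forall>p. filterlim p F sequentially \<longrightarrow>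
           (\<exists>q. (\<forall>\<^sub>F k in sequentially. q k \<in> S (p k)) \<and> q \<longlonglongrightarrow> w)}"

text \<open>
  Convergence to \<open>x\<close> through points of \<open>\<Omega>\<close>.  Unlike \<open>at x within \<Omega>\<close>, this does not
  exclude the point \<open>x\<close> itself.
\<close>

definition nhds_in :: "'a::topological_space set \<Rightarrow> 'a \<Rightarrow> 'a filter" where
  "nhds_in \<Omega> x = inf (nhds x) (principal \<Omega>)"

definition diff_quotient :: "'a::real_vector set \<Rightarrow> 'a \<Rightarrow> real \<Rightarrow> 'a set" where
  "diff_quotient \<Omega> x t = (\<lambda>z. (z - x) /\<^sub>R t) ` \<Omega>"


section \<open>Tangent and normal cones\<close>

definition polar_cone :: "'a::real_inner set \<Rightarrow> 'a set" where
  "polar_cone K = {v. \<forall>w\<in>K. v \<bullet> w \<le> 0}"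

definition tangent_cone :: "'a::real_normed_vector set \<Rightarrow> 'a \<Rightarrow> 'a set" where
  "tangent_cone \<Omega> x = outer_limit (diff_quotient \<Omega> x) (at_right 0)"

definition regular_normal_cone :: "'a::real_inner set \<Rightarrow> 'a \<Rightarrow> 'a set" where
  "regular_normal_cone \<Omega> x = polar_cone (tangent_cone \<Omega> x)"

definition limiting_normal_cone :: "'a::real_inner set \<Rightarrow> 'a \<Rightarrow> 'a set" where
  "limiting_normal_cone \<Omega> x = outer_limit (regular_normal_cone \<Omega>) (nhds_in \<Omega> x)"


section \<open>Subgradients and coderivatives\<close>

text \<open>
  The library constant \<open>epigraph\<close> only covers real-valued functions; as there, the epigraph
  of an extended-real-valued function is a subset of the domain times the real line.
\<close>

definition epi :: "('a \<Rightarrow> ereal) \<Rightarrow> ('a \<times> real) set" where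
  "epi f = {(x, r). f x \<le> ereal r}"

text \<open>The subdifferential is empty at points where \<open>f\<close> is not finite.\<close>

definition subdifferential :: "('a::real_inner \<Rightarrow> ereal) \<Rightarrow> 'a \<Rightarrow> 'a set" where
  "subdifferential f x =
     {v. \<bar>f x\<bar> \<noteq> \<infinity> \<and> (v, -1) \<in> limiting_normal_cone (epi f) (x, real_of_ereal (f x))}"

definition gph :: "('a \<Rightarrow> 'b set) \<Rightarrow> ('a \<times> 'b) set" where
  "gph F = {(x, y). y \<in> F x}"

definition coderivative ::
  "('a::real_inner \<Rightarrow> 'b::real_inner set) \<Rightarrow> 'a \<Rightarrow> 'b \<Rightarrow> 'b \<Rightarrow> 'a set" where
  "coderivative F x y u = {w. (w, - u) \<in> limiting_normal_cone (gph F) (x, y)}"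


section \<open>Strict proto-differentiability\<close>

definition paratingent_cone :: "'a::real_normed_vector set \<Rightarrow> 'a \<Rightarrow> 'a set" where
  "paratingent_cone \<Omega> x =
     outer_limit (\<lambda>(t, z). diff_quotient \<Omega> z t) (at_right 0 \<times>\<^sub>F nhds_in \<Omega> x)"

definition regular_tangent_cone :: "'a::real_normed_vector set \<Rightarrow> 'a \<Rightarrow> 'a set" where
  "regular_tangent_cone \<Omega> x =
     inner_limit (\<lambda>(t, z). diff_quotient \<Omega> z t) (at_right 0 \<times>\<^sub>F nhds_in \<Omega> x)"

definition strictly_proto_differentiable ::
  "('a::real_normed_vector \<Rightarrow> 'b::real_normed_vector set) \<Rightarrow> 'a \<Rightarrow> 'b \<Rightarrow> bool" where
  "strictly_proto_differentiable F x y \<longleftrightarrow>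
     y \<in> F x \<and> paratingent_cone (gph F) (x, y) = regular_tangent_cone (gph F) (x, y)"


section \<open>Composite representations\<close>

definition proper_fun :: "('a \<Rightarrow> ereal) \<Rightarrow> bool" where
  "proper_fun g \<longleftrightarrow> (\<forall>y. g y \<noteq> -\<infinity>) \<and> (\<exists>y. g y \<noteq> \<infinity>)"

definition polyhedral_fun :: "('a::euclidean_space \<Rightarrow> ereal) \<Rightarrow> bool" where
  "polyhedral_fun g \<longleftrightarrow> proper_fun g \<and> polyhedron (epi g)"

definition twice_cont_diff_around ::
  "('a::real_normed_vector \<Rightarrow> 'b::real_normed_vector) \<Rightarrow> 'a \<Rightarrow> bool" where
  "twice_cont_diff_around \<Phi> x \<longleftrightarrow>
     (\<exists>W (D :: 'a \<Rightarrow> 'a \<Rightarrow>\<^sub>L 'b) (D2 :: 'a \<Rightarrow> 'a \<Rightarrow>\<^sub>L ('a \<Rightarrow>\<^sub>L 'b)).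
        open W \<and> x \<in> W \<and>
        (\<forall>z\<in>W. (\<Phi> has_derivative blinfun_apply (D z)) (at z)) \<and>
        (\<forall>z\<in>W. (D has_derivative blinfun_apply (D2 z)) (at z)) \<and>
        continuous_on W D2)"

definition composite_representation ::
  "(real^'n \<Rightarrow> ereal) \<Rightarrow> (real^'m \<Rightarrow> ereal) \<Rightarrow> (real^'n \<Rightarrow> real^'m) \<Rightarrow> real^'n \<Rightarrow> bool" where
  "composite_representation \<phi> g \<Phi> x \<longleftrightarrow>
     twice_cont_diff_around \<Phi> x \<and> polyhedral_fun g \<and>
     (\<exists>O'. open O' \<and> x \<in> O' \<and> (\<forall>z\<in>O'. \<phi> z = g (\<Phi> z)))"

abbreviation adjoint_jacobian ::
  "(real^'n \<Rightarrow> real^'m) \<Rightarrow> real^'n \<Rightarrow> real^'m^'n" where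
  "adjoint_jacobian \<Phi> x \<equiv> transpose (jacobian \<Phi> (at x))"

definition multipliers ::
  "(real^'m \<Rightarrow> ereal) \<Rightarrow> (real^'n \<Rightarrow> real^'m) \<Rightarrow> real^'n \<Rightarrow> real^'n \<Rightarrow> (real^'m) set" where
  "multipliers g \<Phi> x v =
     {l. adjoint_jacobian \<Phi> x *v l = v \<and> l \<in> subdifferential g (\<Phi> x)}"

definition SOQC ::
  "(real^'m \<Rightarrow> ereal) \<Rightarrow> (real^'n \<Rightarrow> real^'m) \<Rightarrow> real^'n \<Rightarrow> real^'m \<Rightarrow> bool" where
  "SOQC g \<Phi> x l \<longleftrightarrow>
     coderivative (subdifferential g) (\<Phi> x) l 0 \<inter> {y. adjoint_jacobian \<Phi> x *v y = 0} = {0}"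

end

theory Submission
  imports Defs
begin

text \<open>
  Monotonicity of \<open>\<partial>g\<close> shows that SOQC forces the adjoint of \<open>A = \<nabla>\<Phi>(xb)\<close> to be injective on the
  subspace \<open>L\<close> parallel to \<open>\<partial>g(\<Phi>(xb))\<close>. Near \<open>\<Phi>(xb)\<close> the polyhedral function \<open>g\<close> is affine with slope
  \<open>lb\<close> plus a sublinear function that depends only on the component in \<open>L\<close>, so injectivity yields a
  local \<open>C\<^sup>2\<close> change of coordinates \<open>\<Theta>\<close> and a \<open>C\<^sup>2\<close> function \<open>f\<close> with \<open>\<phi> = f + p \<circ> \<Theta>\<close>, \<open>p\<close> the support
  function of a convex set \<open>D\<close> and \<open>\<partial>\<phi>(xb) = vb + D\<close>. Strict proto-differentiability is invariant under
  strictly differentiable changes of coordinates, which reduces the claim to \<open>gph \<partial>p\<close> at \<open>(0, 0)\<close>.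
  If \<open>0 \<in> ri D\<close>, this graph is locally a subspace. Conversely, \<open>gph \<partial>p\<close> contains \<open>(k, 0)\<close> for every
  \<open>k\<close> normal to \<open>D\<close> at \<open>0\<close>; since the paratingent cone is symmetric, equality of the cones makes \<open>-k\<close>
  tangent, hence by monotonicity also normal, and a supporting hyperplane gives \<open>0 \<in> ri D\<close>.
\<close>

section \<open>Tangent and normal cones\<close>

text \<open>The obstacle is that SOQC does not make the derivative \<open>A\<close> surjective: its
  adjoint is injective on \<open>L\<close> only, so \<open>\<Phi>\<close> itself cannot serve as a
  coordinate system. The way out is that near \<open>\<Phi> xb\<close> the non-affine part of
  \<open>g\<close> sees \<open>\<Phi> x\<close> only through inner products with elements of
  \<open>L\<close>, and these can be reproduced exactly by a map of the domain into itself whose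
  derivative at \<open>xb\<close> is the identity. Near the base point,
  \<open>gph \<partial>\<phi>\<close> is parametrized by
  \<open>(x, F x + adjoint (\<Theta>' x) \<mu>)\<close> with \<open>F\<close> the gradient of
  \<open>f\<close> and \<open>\<mu>\<close> a subgradient of \<open>p\<close> at
  \<open>\<Theta> x\<close>. This map already contains first derivatives of \<open>\<Phi>\<close>;
  making it strictly differentiable is what consumes the second ones. Since \<open>\<phi>\<close>
  need not be convex, its subgradients are reached through limiting normals to its epigraph, which a
  change of coordinates transports in both directions.\<close>

lemma filterlim_nhds_in:
  "filterlim f (nhds_in S x) F \<longleftrightarrow> (f \<longlongrightarrow> x) F \<and> (\<forall>\<^sub>F k in F. f k \<in> S)"
  by (simp add: nhds_in_def filterlim_inf filterlim_principal)

lemma filterlim_at_right_0: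
  "filterlim (t :: 'a \<Rightarrow> real) (at_right 0) F \<longleftrightarrow> (t \<longlongrightarrow> 0) F \<and> (\<forall>\<^sub>F k in F. 0 < t k)"
  by (auto simp: filterlim_at elim: eventually_mono)

lemma mem_diff_quotient:
  assumes "0 < t"
  shows "q \<in> diff_quotient \<Omega> x t \<longleftrightarrow> x + t *\<^sub>R q \<in> \<Omega>"
proof
  assume "q \<in> diff_quotient \<Omega> x t"
  then show "x + t *\<^sub>R q \<in> \<Omega>"
    using assms by (auto simp: diff_quotient_def)
next
  assume "x + t *\<^sub>R q \<in> \<Omega>"
  then show "q \<in> diff_quotient \<Omega> x t"
    using assms unfolding diff_quotient_def by (intro image_eqI[of _ _ "x + t *\<^sub>R q"]) auto
qed

lemma eventually_mem_diff_quotient: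
  assumes "\<forall>\<^sub>F k in F. 0 < t k"
  shows "(\<forall>\<^sub>F k in F. q k \<in> diff_quotient \<Omega> (z k) (t k)) \<longleftrightarrow> (\<forall>\<^sub>F k in F. z k + t k *\<^sub>R q k \<in> \<Omega>)"
  by (rule eventually_cong[OF assms]) (simp add: mem_diff_quotient)

lemma tangent_cone_iff:
  "w \<in> tangent_cone \<Omega> x \<longleftrightarrow>
     (\<exists>t q. t \<longlonglongrightarrow> 0 \<and> (\<forall>\<^sub>F k in sequentially. 0 < t k) \<and> q \<longlonglongrightarrow> w \<and>
        (\<forall>\<^sub>F k in sequentially. x + t k *\<^sub>R q k \<in> \<Omega>))"
  (is "?L \<longleftrightarrow> ?R")
proof
  assume ?L
  then obtain t q where *: "t \<longlonglongrightarrow> 0" "\<forall>\<^sub>F k in sequentially. 0 < t k" "q \<longlonglongrightarrow> w"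
    "\<forall>\<^sub>F k in sequentially. q k \<in> diff_quotient \<Omega> x (t k)"
    unfolding tangent_cone_def outer_limit_def mem_Collect_eq filterlim_at_right_0 by blast
  then show ?R
    using eventually_mem_diff_quotient[OF *(2), of q \<Omega> "\<lambda>_. x"] by blast
next
  assume ?R
  then obtain t q where *: "t \<longlonglongrightarrow> 0" "\<forall>\<^sub>F k in sequentially. 0 < t k" "q \<longlonglongrightarrow> w"
    "\<forall>\<^sub>F k in sequentially. x + t k *\<^sub>R q k \<in> \<Omega>"
    by blast
  then show ?L
    using eventually_mem_diff_quotient[OF *(2), of q \<Omega> "\<lambda>_. x"]
    unfolding tangent_cone_def outer_limit_def mem_Collect_eq filterlim_at_right_0 by blast
qed

lemma filterlim_prod_iff:
  "filterlim p (F \<times>\<^sub>F G) H \<longleftrightarrow> filterlim (\<lambda>k. fst (p k)) F H \<and> filterlim (\<lambda>k. snd (p k)) G H"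
  using filterlim_compose[OF filterlim_fst, of p F G H] filterlim_compose[OF filterlim_snd, of p F G H]
    filterlim_Pair[of "\<lambda>k. fst (p k)" F H "\<lambda>k. snd (p k)" G]
  by auto

lemma paratingent_cone_iff:
  "w \<in> paratingent_cone \<Omega> x \<longleftrightarrow>
     (\<exists>t z q. t \<longlonglongrightarrow> 0 \<and> (\<forall>\<^sub>F k in sequentially. 0 < t k) \<and>
        z \<longlonglongrightarrow> x \<and> (\<forall>\<^sub>F k in sequentially. z k \<in> \<Omega>) \<and>
        q \<longlonglongrightarrow> w \<and> (\<forall>\<^sub>F k in sequentially. z k + t k *\<^sub>R q k \<in> \<Omega>))"
  (is "?L \<longleftrightarrow> ?R")
proof
  assume ?L
  then obtain p q where p: "filterlim p (at_right 0 \<times>\<^sub>F nhds_in \<Omega> x) sequentially"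
    and q: "\<forall>\<^sub>F k in sequentially. q k \<in> diff_quotient \<Omega> (snd (p k)) (fst (p k))" "q \<longlonglongrightarrow> w"
    by (auto simp: paratingent_cone_def outer_limit_def case_prod_beta)
  then have pos: "\<forall>\<^sub>F k in sequentially. 0 < fst (p k)"
    by (simp add: filterlim_prod_iff filterlim_at_right_0)
  show ?R
    using p q pos eventually_mem_diff_quotient[OF pos, of q \<Omega> "\<lambda>k. snd (p k)"]
    by (intro exI[of _ "\<lambda>k. fst (p k)"] exI[of _ "\<lambda>k. snd (p k)"] exI[of _ q])
      (simp add: filterlim_prod_iff filterlim_at_right_0 filterlim_nhds_in)
next
  assume ?R
  then obtain t z q where *: "t \<longlonglongrightarrow> 0" "\<forall>\<^sub>F k in sequentially. 0 < t k"
    "z \<longlonglongrightarrow> x" "\<forall>\<^sub>F k in sequentially. z k \<in> \<Omega>"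
    "q \<longlonglongrightarrow> w" "\<forall>\<^sub>F k in sequentially. z k + t k *\<^sub>R q k \<in> \<Omega>"
    by blast
  show ?L
    unfolding paratingent_cone_def outer_limit_def mem_Collect_eq
    using * eventually_mem_diff_quotient[OF *(2), of q \<Omega> z]
    by (intro exI[of _ "\<lambda>k. (t k, z k)"] exI[of _ q])
      (simp add: filterlim_prod_iff filterlim_at_right_0 filterlim_nhds_in)
qed

lemma regular_tangent_cone_iff:
  "w \<in> regular_tangent_cone \<Omega> x \<longleftrightarrow>
     (\<forall>t z. t \<longlonglongrightarrow> 0 \<longrightarrow> (\<forall>\<^sub>F k in sequentially. 0 < t k) \<longrightarrow>
        z \<longlonglongrightarrow> x \<longrightarrow> (\<forall>\<^sub>F k in sequentially. z k \<in> \<Omega>) \<longrightarrow>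
        (\<exists>q. q \<longlonglongrightarrow> w \<and> (\<forall>\<^sub>F k in sequentially. z k + t k *\<^sub>R q k \<in> \<Omega>)))"
  (is "?L \<longleftrightarrow> ?R")
proof
  assume L: ?L
  show ?R
  proof (intro allI impI)
    fix t :: "nat \<Rightarrow> real" and z
    assume *: "t \<longlonglongrightarrow> 0" "\<forall>\<^sub>F k in sequentially. 0 < t k"
      "z \<longlonglongrightarrow> x" "\<forall>\<^sub>F k in sequentially. z k \<in> \<Omega>"
    then have "filterlim (\<lambda>k. (t k, z k)) (at_right 0 \<times>\<^sub>F nhds_in \<Omega> x) sequentially"
      by (simp add: filterlim_prod_iff filterlim_at_right_0 filterlim_nhds_in)
    with L obtain q where "\<forall>\<^sub>F k in sequentially. q k \<in> diff_quotient \<Omega> (z k) (t k)" "q \<longlonglongrightarrow> w"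
      by (auto simp: regular_tangent_cone_def inner_limit_def)
    then show "\<exists>q. q \<longlonglongrightarrow> w \<and> (\<forall>\<^sub>F k in sequentially. z k + t k *\<^sub>R q k \<in> \<Omega>)"
      using eventually_mem_diff_quotient[OF *(2), of q \<Omega> z] by blast
  qed
next
  assume R: ?R
  show ?L
    unfolding regular_tangent_cone_def inner_limit_def mem_Collect_eq
  proof (intro allI impI)
    fix p :: "nat \<Rightarrow> real \<times> 'a"
    assume p: "filterlim p (at_right 0 \<times>\<^sub>F nhds_in \<Omega> x) sequentially"
    then have pos: "\<forall>\<^sub>F k in sequentially. 0 < fst (p k)"
      by (simp add: filterlim_prod_iff filterlim_at_right_0)
    from p R obtain q where "q \<longlonglongrightarrow> w"
      "\<forall>\<^sub>F k in sequentially. snd (p k) + fst (p k) *\<^sub>R q k \<in> \<Omega>"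
      by (auto simp: filterlim_prod_iff filterlim_at_right_0 filterlim_nhds_in)
    then show "\<exists>q. (\<forall>\<^sub>F k in sequentially. q k \<in> (case p k of (t, z) \<Rightarrow> diff_quotient \<Omega> z t)) \<and> q \<longlonglongrightarrow> w"
      using eventually_mem_diff_quotient[OF pos, of q \<Omega> "\<lambda>k. snd (p k)"]
      by (auto simp: case_prod_beta)
  qed
qed

text \<open>Membership \<open>x \<in> \<Omega>\<close> makes the common filter nontrivial: the base
  points constant at \<open>x\<close> with steps \<open>1 / (k + 1)\<close> run along it, and the
  answer of the inner limit to them is a witness for the outer limit.\<close>

lemma regular_tangent_cone_subset_paratingent_cone:
  assumes "x \<in> \<Omega>"
  shows "regular_tangent_cone \<Omega> x \<subseteq> paratingent_cone \<Omega> x"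
proof
  fix w assume "w \<in> regular_tangent_cone \<Omega> x"
  from this[unfolded regular_tangent_cone_iff, rule_format, OF LIMSEQ_inverse_real_of_nat _ tendsto_const]
  obtain q where "q \<longlonglongrightarrow> w"
    "\<forall>\<^sub>F k in sequentially. x + inverse (real (Suc k)) *\<^sub>R q k \<in> \<Omega>"
    using assms by auto
  then show "w \<in> paratingent_cone \<Omega> x"
    unfolding paratingent_cone_iff using assms LIMSEQ_inverse_real_of_nat
    by (intro exI[of _ "\<lambda>k. inverse (real (Suc k))"] exI[of _ "\<lambda>_. x"] exI[of _ q]) auto
qed

lemma limiting_normal_cone_iff:
  "v \<in> limiting_normal_cone \<Omega> x \<longleftrightarrow>
     (\<exists>z u. z \<longlonglongrightarrow> x \<and> (\<forall>\<^sub>F k in sequentially. z k \<in> \<Omega>) \<and>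
        (\<forall>\<^sub>F k in sequentially. u k \<in> regular_normal_cone \<Omega> (z k)) \<and> u \<longlonglongrightarrow> v)"
  unfolding limiting_normal_cone_def outer_limit_def by (auto simp: filterlim_nhds_in)

lemma regular_subset_limiting_normal_cone:
  "x \<in> \<Omega> \<Longrightarrow> regular_normal_cone \<Omega> x \<subseteq> limiting_normal_cone \<Omega> x"
  by (auto simp: limiting_normal_cone_iff intro!: exI[of _ "\<lambda>_. x"] exI[of _ "\<lambda>_. _"])

text \<open>Convexity keeps the segment from \<open>x\<close> to \<open>q\<close> in
  \<open>\<Omega>\<close>, so \<open>q - x\<close> is itself tangent; conversely every tangent
  vector is a limit of positive multiples of such differences.\<close>

lemma regular_normal_cone_convex:
  assumes "convex \<Omega>" "x \<in> \<Omega>"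
  shows "regular_normal_cone \<Omega> x = {v. \<forall>q\<in>\<Omega>. v \<bullet> (q - x) \<le> 0}"
proof (intro equalityI subsetI CollectI ballI)
  fix v q assume v: "v \<in> regular_normal_cone \<Omega> x" and q: "q \<in> \<Omega>"
  have "x + inverse (real (Suc k)) *\<^sub>R (q - x) \<in> \<Omega>" for k
    using convexD_alt[OF \<open>convex \<Omega>\<close> \<open>x \<in> \<Omega>\<close> q, of "inverse (real (Suc k))"]
    by (simp add: algebra_simps inverse_le_1_iff)
  then have "q - x \<in> tangent_cone \<Omega> x"
    unfolding tangent_cone_iff using LIMSEQ_inverse_real_of_nat
    by (intro exI[of _ "\<lambda>k. inverse (real (Suc k))"] exI[of _ "\<lambda>_. q - x"]) auto
  with v show "v \<bullet> (q - x) \<le> 0"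
    by (auto simp: regular_normal_cone_def polar_cone_def)
next
  fix v assume v: "v \<in> {v. \<forall>q\<in>\<Omega>. v \<bullet> (q - x) \<le> 0}"
  show "v \<in> regular_normal_cone \<Omega> x"
    unfolding regular_normal_cone_def polar_cone_def
  proof (intro CollectI ballI)
    fix w assume "w \<in> tangent_cone \<Omega> x"
    then obtain t q where *: "\<forall>\<^sub>F k in sequentially. 0 < t k" "q \<longlonglongrightarrow> w"
      "\<forall>\<^sub>F k in sequentially. x + t k *\<^sub>R q k \<in> \<Omega>"
      unfolding tangent_cone_iff by blast
    have ev: "\<forall>\<^sub>F k in sequentially. v \<bullet> q k \<le> 0"
      using *(1,3)
    proof eventually_elim
      case (elim k)
      with v have "v \<bullet> (x + t k *\<^sub>R q k - x) \<le> 0" by blast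
      with elim show ?case by (simp add: mult_le_0_iff)
    qed
    have "(\<lambda>k. v \<bullet> q k) \<longlonglongrightarrow> v \<bullet> w"
      by (intro tendsto_intros *)
    then show "v \<bullet> w \<le> 0"
      using ev by (rule tendsto_upperbound) simp
  qed
qed

text \<open>For fixed \<open>q\<close> the normality inequality survives limits in the base point
  and in the normal, so limits create no new normals.\<close>

lemma limiting_normal_cone_convex:
  assumes "convex \<Omega>" "x \<in> \<Omega>"
  shows "limiting_normal_cone \<Omega> x = {v. \<forall>q\<in>\<Omega>. v \<bullet> (q - x) \<le> 0}"
proof (rule antisym)
  show "{v. \<forall>q\<in>\<Omega>. v \<bullet> (q - x) \<le> 0} \<subseteq> limiting_normal_cone \<Omega> x"
    using regular_subset_limiting_normal_cone[OF assms(2)] regular_normal_cone_convex[OF assms] by simp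
  show "limiting_normal_cone \<Omega> x \<subseteq> {v. \<forall>q\<in>\<Omega>. v \<bullet> (q - x) \<le> 0}"
  proof (intro subsetI CollectI ballI)
    fix v q assume v: "v \<in> limiting_normal_cone \<Omega> x" and q: "q \<in> \<Omega>"
    then obtain z u where *: "z \<longlonglongrightarrow> x" "\<forall>\<^sub>F k in sequentially. z k \<in> \<Omega>"
      "\<forall>\<^sub>F k in sequentially. u k \<in> regular_normal_cone \<Omega> (z k)" "u \<longlonglongrightarrow> v"
      unfolding limiting_normal_cone_iff by blast
    have ev: "\<forall>\<^sub>F k in sequentially. u k \<bullet> (q - z k) \<le> 0"
      using *(2,3) by eventually_elim (use q regular_normal_cone_convex[OF assms(1)] in blast)
    have "(\<lambda>k. u k \<bullet> (q - z k)) \<longlonglongrightarrow> v \<bullet> (q - x)"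
      by (intro tendsto_intros *)
    then show "v \<bullet> (q - x) \<le> 0"
      using ev by (rule tendsto_upperbound) simp
  qed
qed

section \<open>Tangent and normal cones under differentiable maps\<close>

lemma tangent_cone_image:
  fixes H :: "'a::real_normed_vector \<Rightarrow> 'b::real_normed_vector"
  assumes der: "(H has_derivative H') (at x)"
    and loc: "\<forall>\<^sub>F z in nhds x. z \<in> \<Omega> \<longrightarrow> H z \<in> Q"
    and w: "w \<in> tangent_cone \<Omega> x"
  shows "H' w \<in> tangent_cone Q (H x)"
proof -
  obtain t q where *: "t \<longlonglongrightarrow> 0" "\<forall>\<^sub>F k in sequentially. 0 < t k" "q \<longlonglongrightarrow> w"
      "\<forall>\<^sub>F k in sequentially. x + t k *\<^sub>R q k \<in> \<Omega>"
    using w unfolding tangent_cone_iff by blast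
  interpret bounded_linear H' by (rule has_derivative_bounded_linear[OF der])
  define r where "r k = (1 / t k) *\<^sub>R (H (x + t k *\<^sub>R q k) - H x)" for k
  have tq: "(\<lambda>k. t k *\<^sub>R q k) \<longlonglongrightarrow> 0"
    using tendsto_scaleR[OF *(1,3)] by simp
  have xtq: "(\<lambda>k. x + t k *\<^sub>R q k) \<longlonglongrightarrow> x"
    using tendsto_add[OF tendsto_const tq] by simp
  \<comment> \<open>The relative remainder gets the value 0 at \<open>h = 0\<close>, because
    \<open>t k *\<^sub>R q k\<close> may vanish; continuity of \<open>E\<close> at 0 then covers
    every \<open>k\<close>.\<close>
  define E where "E h = (if h = 0 then 0 else norm (H (x + h) - H x - H' h) / norm h)" for h
  have "(E \<longlongrightarrow> 0) (at 0)"
    using der unfolding has_derivative_at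
    by (rule Lim_transform_eventually[OF conjunct2]) (auto simp: eventually_at_filter E_def)
  then have "isCont E 0" by (simp add: isCont_def E_def)
  then have E0: "(\<lambda>k. E (t k *\<^sub>R q k)) \<longlonglongrightarrow> 0"
    using isCont_tendsto_compose[OF _ tq, of E] by (simp add: E_def)
  have lim0: "(\<lambda>k. r k - H' (q k)) \<longlonglongrightarrow> 0"
  proof (rule Lim_null_comparison)
    show "\<forall>\<^sub>F k in sequentially. norm (r k - H' (q k)) \<le> E (t k *\<^sub>R q k) * norm (q k)"
      using *(2)
    proof eventually_elim
      case (elim k)
      have "H' (q k) = (1 / t k) *\<^sub>R H' (t k *\<^sub>R q k)"
        using elim by (simp add: scaleR)
      then have "r k - H' (q k) = (1 / t k) *\<^sub>R (H (x + t k *\<^sub>R q k) - H x - H' (t k *\<^sub>R q k))"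
        by (simp only: r_def scaleR_diff_right)
      then have "norm (r k - H' (q k)) = norm (H (x + t k *\<^sub>R q k) - H x - H' (t k *\<^sub>R q k)) / t k"
        using elim by simp
      also have "\<dots> = E (t k *\<^sub>R q k) * norm (q k)"
        using elim by (simp add: E_def zero)
      finally show ?case by simp
    qed
    show "(\<lambda>k. E (t k *\<^sub>R q k) * norm (q k)) \<longlonglongrightarrow> 0"
      using tendsto_mult[OF E0 tendsto_norm[OF *(3)]] by simp
  qed
  have "r \<longlonglongrightarrow> H' w"
    using tendsto_add[OF lim0 tendsto[OF *(3)]] by simp
  moreover have "\<forall>\<^sub>F k in sequentially. H x + t k *\<^sub>R r k \<in> Q"
    using *(2,4) eventually_compose_filterlim[OF loc xtq]
    by eventually_elim (simp add: r_def)
  ultimately show ?thesis unfolding tangent_cone_iff using * by blast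
qed

text \<open>The \<open>i\<close>-th coordinate of the adjoint is \<open>v k \<bullet> T k i\<close>,
  so in finite dimension pointwise convergence of the operators is enough.\<close>

lemma tendsto_adjoint:
  fixes T :: "'c \<Rightarrow> 'a::euclidean_space \<Rightarrow> 'b::euclidean_space"
  assumes T: "\<And>u. ((\<lambda>k. T k u) \<longlongrightarrow> T0 u) F" and lin: "\<forall>\<^sub>F k in F. linear (T k)" "linear T0"
    and v: "(v \<longlongrightarrow> v0) F"
  shows "((\<lambda>k. adjoint (T k) (v k)) \<longlongrightarrow> adjoint T0 v0) F"
proof (rule tendsto_componentwise_iff[THEN iffD2], rule ballI)
  fix i :: 'a
  have "((\<lambda>k. v k \<bullet> T k i) \<longlongrightarrow> v0 \<bullet> T0 i) F"
    by (intro tendsto_intros T v)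
  moreover have "\<forall>\<^sub>F k in F. v k \<bullet> T k i = adjoint (T k) (v k) \<bullet> i"
    using lin(1) by eventually_elim (simp add: adjoint_works inner_commute)
  ultimately show "((\<lambda>k. adjoint (T k) (v k) \<bullet> i) \<longlongrightarrow> adjoint T0 v0 \<bullet> i) F"
    using lin(2) by (simp add: adjoint_works inner_commute tendsto_cong)
qed

text \<open>Regular normals pull back at each nearby point by duality with the image of tangent
  vectors, and continuity of \<open>H'\<close> carries this to the limit. The inverse
  \<open>Hi\<close> supplies the base points in \<open>\<Omega>\<close>. The opposite inclusion
  comes from applying the same fact to the inverse map.\<close>

lemma limiting_normal_cone_pullback:
  fixes H :: "'a::euclidean_space \<Rightarrow> 'b::euclidean_space"
  assumes hom: "homeomorphism U V H Hi" and op: "open U" "open V" and x: "x \<in> U"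
    and der: "\<And>z. z \<in> U \<Longrightarrow> (H has_derivative H' z) (at z)"
    and cont: "\<And>u. continuous_on U (\<lambda>z. H' z u)"
    and eq: "\<And>z. z \<in> U \<Longrightarrow> z \<in> \<Omega> \<longleftrightarrow> H z \<in> Q"
    and v: "v \<in> limiting_normal_cone Q (H x)"
  shows "adjoint (H' x) v \<in> limiting_normal_cone \<Omega> x"
proof -
  obtain y u where *: "y \<longlonglongrightarrow> H x" "\<forall>\<^sub>F k in sequentially. y k \<in> Q"
    "\<forall>\<^sub>F k in sequentially. u k \<in> regular_normal_cone Q (y k)" "u \<longlonglongrightarrow> v"
    using v unfolding limiting_normal_cone_iff by blast
  have Hx: "H x \<in> V" "Hi (H x) = x"
    using hom x by (auto simp: homeomorphism_def)
  have yV: "\<forall>\<^sub>F k in sequentially. y k \<in> V"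
    using *(1) op(2) Hx(1) by (rule topological_tendstoD)
  have "isCont Hi (H x)"
    using hom op(2) Hx by (auto simp: homeomorphism_def continuous_on_eq_continuous_at)
  then have lim: "(\<lambda>k. Hi (y k)) \<longlonglongrightarrow> x"
    using isCont_tendsto_compose[OF _ *(1), of Hi] Hx by simp
  have U: "\<forall>\<^sub>F k in sequentially. Hi (y k) \<in> U \<and> H (Hi (y k)) = y k"
    using yV by eventually_elim (use hom in \<open>auto simp: homeomorphism_def\<close>)
  have reg: "adjoint (H' z) u \<in> regular_normal_cone \<Omega> z"
    if "z \<in> U" "u \<in> regular_normal_cone Q (H z)" for z u
    unfolding regular_normal_cone_def polar_cone_def
  proof (intro CollectI ballI)
    fix w assume w: "w \<in> tangent_cone \<Omega> z"
    have "\<forall>\<^sub>F y in nhds z. y \<in> \<Omega> \<longrightarrow> H y \<in> Q"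
      using eventually_nhds_in_open[OF op(1) that(1)] by eventually_elim (use eq in blast)
    from tangent_cone_image[OF der[OF that(1)] this w] have "u \<bullet> H' z w \<le> 0"
      using that(2) by (auto simp: regular_normal_cone_def polar_cone_def)
    then show "adjoint (H' z) u \<bullet> w \<le> 0"
      by (metis adjoint_works der has_derivative_linear inner_commute that(1))
  qed
  have "(\<lambda>k. adjoint (H' (Hi (y k))) (u k)) \<longlonglongrightarrow> adjoint (H' x) v"
  proof (rule tendsto_adjoint)
    show "\<forall>\<^sub>F k in sequentially. linear (H' (Hi (y k)))"
      using U by eventually_elim (use der has_derivative_linear in blast)
    show "linear (H' x)" using der[OF x] by (rule has_derivative_linear)
    show "(\<lambda>k. H' (Hi (y k)) a) \<longlonglongrightarrow> H' x a" for a
      using cont[of a] op(1) x lim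
      by (auto simp: continuous_on_eq_continuous_at intro: isCont_tendsto_compose)
  qed (rule *)
  moreover have "\<forall>\<^sub>F k in sequentially. Hi (y k) \<in> \<Omega>"
    using U *(2) by eventually_elim (use eq in force)
  moreover have "\<forall>\<^sub>F k in sequentially. adjoint (H' (Hi (y k))) (u k) \<in> regular_normal_cone \<Omega> (Hi (y k))"
    using U *(3) by eventually_elim (use reg in force)
  ultimately show ?thesis
    unfolding limiting_normal_cone_iff using lim
    by (intro exI[of _ "\<lambda>k. Hi (y k)"] exI[of _ "\<lambda>k. adjoint (H' (Hi (y k))) (u k)"] conjI)
qed


section \<open>Strict derivatives\<close>

text \<open>Both points of the difference vary, as the base points do in the paratingent and regular
  tangent cones; an ordinary derivative controls only differences based at \<open>x\<close>.\<close>

definition has_strict_derivative ::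
  "('a::real_normed_vector \<Rightarrow> 'b::real_normed_vector) \<Rightarrow> ('a \<Rightarrow> 'b) \<Rightarrow> 'a \<Rightarrow> bool" where
  "has_strict_derivative f f' x \<longleftrightarrow> bounded_linear f' \<and>
     (\<forall>e>0. \<exists>d>0. \<forall>y z. dist y x < d \<longrightarrow> dist z x < d \<longrightarrow>
        norm (f y - f z - f' (y - z)) \<le> e * norm (y - z))"

lemma has_strict_derivative_sequentially:
  assumes f: "has_strict_derivative f f' x"
    and t: "\<forall>\<^sub>F k in sequentially. 0 < t k" "t \<longlonglongrightarrow> 0"
    and z: "z \<longlonglongrightarrow> x" and q: "q \<longlonglongrightarrow> w"
  shows "(\<lambda>k. (1 / t k) *\<^sub>R (f (z k + t k *\<^sub>R q k) - f (z k))) \<longlonglongrightarrow> f' w" (is "?r \<longlonglongrightarrow> _")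
proof -
  interpret bounded_linear f' using f by (simp add: has_strict_derivative_def)
  have y: "(\<lambda>k. z k + t k *\<^sub>R q k) \<longlonglongrightarrow> x"
    using tendsto_add[OF z tendsto_scaleR[OF t(2) q]] by simp
  have "(\<lambda>k. ?r k - f' (q k)) \<longlonglongrightarrow> 0"
    unfolding tendsto_iff dist_norm diff_0_right
  proof (intro allI impI)
    fix e :: real assume e: "e > 0"
    \<comment> \<open>Eventually \<open>norm (q k) < norm w + 1\<close>, so a relative error
      \<open>c\<close> per unit of displacement stays below \<open>e\<close>.\<close>
    define c where "c = e / (norm w + 1)"
    have "c > 0" using e by (simp add: c_def add_nonneg_pos)
    with f obtain d where d: "d > 0" and
      D: "\<And>y z. dist y x < d \<Longrightarrow> dist z x < d \<Longrightarrow> norm (f y - f z - f' (y - z)) \<le> c * norm (y - z)"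
      unfolding has_strict_derivative_def by blast
    have "\<forall>\<^sub>F k in sequentially. norm (q k) < norm w + 1"
      using order_tendstoD(2)[OF tendsto_norm[OF q], of "norm w + 1"] by simp
    then show "\<forall>\<^sub>F k in sequentially. norm (?r k - f' (q k)) < e"
      using t(1) tendstoD[OF z d] tendstoD[OF y d]
    proof eventually_elim
      case (elim k)
      have "f' (q k) = (1 / t k) *\<^sub>R f' (t k *\<^sub>R q k)"
        using elim by (simp add: scaleR)
      then have "?r k - f' (q k) = (1 / t k) *\<^sub>R (f (z k + t k *\<^sub>R q k) - f (z k) - f' (t k *\<^sub>R q k))"
        by (simp only: scaleR_diff_right)
      then have "norm (?r k - f' (q k)) = norm (f (z k + t k *\<^sub>R q k) - f (z k) - f' (t k *\<^sub>R q k)) / t k"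
        using elim by simp
      also have "\<dots> \<le> c * norm (t k *\<^sub>R q k) / t k"
        using D[OF elim(4,3)] elim by (intro divide_right_mono) auto
      also have "\<dots> = c * norm (q k)" using elim by simp
      also have "\<dots> < c * (norm w + 1)" using elim \<open>c > 0\<close> by simp
      also have "\<dots> = e" by (simp add: c_def add_nonneg_eq_0_iff)
      finally show ?case .
    qed
  qed
  from tendsto_add[OF this tendsto[OF q]] show ?thesis by simp
qed

lemma has_strict_derivative_continuous:
  assumes f: "has_strict_derivative f f' x"
  shows "isCont f x"
proof -
  interpret bounded_linear f' using f by (simp add: has_strict_derivative_def)
  obtain d where d: "d > 0" and
    D: "\<And>y z. dist y x < d \<Longrightarrow> dist z x < d \<Longrightarrow> norm (f y - f z - f' (y - z)) \<le> 1 * norm (y - z)"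
    using f unfolding has_strict_derivative_def by (metis zero_less_one)
  have "(\<lambda>y. f y - f x - f' (y - x)) \<midarrow>x\<rightarrow> 0"
  proof (rule Lim_null_comparison)
    show "\<forall>\<^sub>F y in at x. norm (f y - f x - f' (y - x)) \<le> norm (y - x)"
      using eventually_at_ball[OF d, of x UNIV]
      by eventually_elim (use D[of _ x] d in \<open>auto simp: dist_commute\<close>)
    show "(\<lambda>y. norm (y - x)) \<midarrow>x\<rightarrow> 0"
      by (intro tendsto_eq_intros) auto
  qed
  moreover have "(\<lambda>y. f' (y - x)) \<midarrow>x\<rightarrow> 0"
    by (rule tendsto_zero) (intro tendsto_eq_intros, auto)
  ultimately have "(\<lambda>y. (f y - f x - f' (y - x)) + f' (y - x) + f x) \<midarrow>x\<rightarrow> 0 + 0 + f x"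
    by (intro tendsto_add tendsto_const)
  then show ?thesis by (simp add: isCont_def)
qed

text \<open>This is the mean value inequality on a ball where \<open>f' z - f' x\<close> has
  operator norm at most \<open>e\<close>. Summing over the finite basis in \<open>B\<close> turns
  pointwise continuity of \<open>f'\<close> into that norm bound.\<close>

lemma has_strict_derivative_C1:
  fixes f :: "'a::euclidean_space \<Rightarrow> 'b::real_normed_vector"
  assumes op: "open U" and x: "x \<in> U"
    and der: "\<And>z. z \<in> U \<Longrightarrow> (f has_derivative f' z) (at z)"
    and cont: "\<And>u. continuous_on U (\<lambda>z. f' z u)"
  shows "has_strict_derivative f (f' x) x"
  unfolding has_strict_derivative_def
proof (intro conjI allI impI)
  interpret x: bounded_linear "f' x" by (rule has_derivative_bounded_linear[OF der[OF x]])
  show "bounded_linear (f' x)" ..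
  fix e :: real assume e: "e > 0"
  define B where "B z = (\<Sum>b\<in>Basis. norm (f' z b - f' x b))" for z
  have "isCont B x"
    unfolding B_def using cont op x by (intro continuous_intros) (auto simp: continuous_on_eq_continuous_at)
  then have "\<forall>\<^sub>F z in nhds x. B z < e"
    using e order_tendstoD(2)[of B "B x" "at x" e] by (simp add: B_def isCont_def eventually_nhds_conv_at)
  then have "\<forall>\<^sub>F z in nhds x. B z < e \<and> z \<in> U"
    using eventually_nhds_in_open[OF op x] by eventually_elim simp
  then obtain d where d: "d > 0" and D: "\<And>z. dist z x < d \<Longrightarrow> B z < e \<and> z \<in> U"
    unfolding eventually_nhds_metric by blast
  have on: "onorm (f' z - f' x) \<le> e" if "dist z x < d" for z
  proof (rule onorm_bound)
    show "0 \<le> e" using e by simp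
    fix u
    interpret z: bounded_linear "f' z" using has_derivative_bounded_linear[OF der] D that by blast
    have "(f' z - f' x) u = (\<Sum>b\<in>Basis. (u \<bullet> b) *\<^sub>R (f' z b - f' x b))"
      by (subst (1) euclidean_representation[of u, symmetric])
        (simp add: z.sum x.sum z.scaleR x.scaleR sum_subtractf scaleR_diff_right fun_diff_def)
    also have "norm \<dots> \<le> (\<Sum>b\<in>Basis. norm u * norm (f' z b - f' x b))"
      by (intro sum_norm_le) (simp add: Basis_le_norm mult_right_mono)
    also have "\<dots> = B z * norm u" by (simp add: B_def sum_distrib_left mult.commute)
    also have "\<dots> \<le> e * norm u" using D that by (intro mult_right_mono) (auto simp: less_imp_le)
    finally show "norm ((f' z - f' x) u) \<le> e * norm u" .
  qed
  show "\<exists>d>0. \<forall>y z. dist y x < d \<longrightarrow> dist z x < d \<longrightarrow> norm (f y - f z - f' x (y - z)) \<le> e * norm (y - z)"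
  proof (intro exI[of _ d] conjI d allI impI)
    fix y z assume yz: "dist y x < d" "dist z x < d"
    have "norm (f y - f z - f' x (y - z)) \<le> norm (y - z) * e"
    proof (rule differentiable_bound_linearization[where S = "ball x d"])
      fix t :: real assume t: "t \<in> {0..1}"
      have "(1 - t) *\<^sub>R z + t *\<^sub>R y \<in> ball x d"
        using yz t by (intro convexD_alt[OF convex_ball]) (auto simp: dist_commute)
      then show "z + t *\<^sub>R (y - z) \<in> ball x d" by (simp add: algebra_simps)
    next
      fix a assume "a \<in> ball x d"
      then show "(f has_derivative f' a) (at a within ball x d)" "onorm (f' a - f' x) \<le> e"
        using der D on by (auto simp: dist_commute intro: has_derivative_at_withinI)
    qed (use d in auto)
    then show "norm (f y - f z - f' x (y - z)) \<le> e * norm (y - z)" by (simp add: mult.commute)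
  qed
qed

text \<open>Strict differentiability of \<open>f\<close> first makes the merely continuous
  \<open>g\<close> Lipschitz near \<open>f a\<close>; the error of \<open>f\<close> then transfers
  to \<open>g\<close>.\<close>

lemma has_strict_derivative_inverse:
  fixes f :: "'a::real_normed_vector \<Rightarrow> 'b::real_normed_vector"
  assumes f: "has_strict_derivative f f' a"
    and inv: "bounded_linear f'i" "\<And>u. f'i (f' u) = u" "\<And>u. f' (f'i u) = u"
    and g: "isCont g (f a)" "g (f a) = a" "\<forall>\<^sub>F y in nhds (f a). f (g y) = y"
  shows "has_strict_derivative g f'i (f a)"
  unfolding has_strict_derivative_def
proof (intro conjI allI impI inv(1))
  interpret i: bounded_linear f'i by fact
  interpret f: bounded_linear f' using f by (simp add: has_strict_derivative_def)
  obtain K where K: "K > 0" "\<And>u. norm (f'i u) \<le> norm u * K"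
    using i.pos_bounded by blast
  fix e :: real assume e: "e > 0"
  \<comment> \<open>The first bound gives \<open>c * K \<le> 1 / 2\<close>, which absorbs the error
    term and yields the Lipschitz constant \<open>2 * K\<close> for \<open>g\<close>; the second
    bounds the resulting total error \<open>2 * K * K * c\<close> by \<open>e\<close>.\<close>
  define c where "c = min (1 / (2 * K)) (e / (2 * K * K))"
  have c: "c > 0" "c * K \<le> 1 / 2" "2 * K * K * c \<le> e"
  proof -
    show "c > 0" using K e by (simp add: c_def)
    have "c * K \<le> 1 / (2 * K) * K" using K by (intro mult_right_mono) (auto simp: c_def)
    then show "c * K \<le> 1 / 2" using K by simp
    have "2 * K * K * c \<le> 2 * K * K * (e / (2 * K * K))" using K by (intro mult_left_mono) (auto simp: c_def)
    then show "2 * K * K * c \<le> e" using K by simp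
  qed
  obtain d where d: "d > 0" and
    D: "\<And>y z. dist y a < d \<Longrightarrow> dist z a < d \<Longrightarrow> norm (f y - f z - f' (y - z)) \<le> c * norm (y - z)"
    using f c(1) unfolding has_strict_derivative_def by blast
  have "\<forall>\<^sub>F y in nhds (f a). dist (g y) a < d \<and> f (g y) = y"
    using g d tendstoD[of g a "at (f a)" d] by (simp add: isCont_def eventually_conj_iff eventually_nhds_conv_at)
  then obtain r where r: "r > 0" and R: "\<And>y. dist y (f a) < r \<Longrightarrow> dist (g y) a < d \<and> f (g y) = y"
    unfolding eventually_nhds_metric by blast
  show "\<exists>d>0. \<forall>y z. dist y (f a) < d \<longrightarrow> dist z (f a) < d \<longrightarrow>
      norm (g y - g z - f'i (y - z)) \<le> e * norm (y - z)"
  proof (intro exI[of _ r] conjI r allI impI)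
    fix y z assume yz: "dist y (f a) < r" "dist z (f a) < r"
    let ?u = "g y - g z"
    have 1: "norm (y - z - f' ?u) \<le> c * norm ?u"
      using D[of "g y" "g z"] R yz by auto
    have "norm (?u - f'i (y - z)) = norm (f'i (y - z - f' ?u))"
      by (simp add: i.diff inv norm_minus_commute)
    also have "\<dots> \<le> norm (y - z - f' ?u) * K" by (rule K)
    also have "\<dots> \<le> c * norm ?u * K" using 1 K by (intro mult_right_mono) auto
    finally have 2: "norm (?u - f'i (y - z)) \<le> c * K * norm ?u" by (simp add: mult_ac)
    have "c * K * norm ?u \<le> 1 / 2 * norm ?u" using c by (intro mult_right_mono) auto
    with 2 have "norm ?u \<le> 2 * norm (f'i (y - z))"
      using norm_triangle_ineq2[of ?u "f'i (y - z)"] by linarith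
    also have "\<dots> \<le> 2 * (norm (y - z) * K)" using K by (intro mult_left_mono) auto
    finally have "c * K * norm ?u \<le> c * K * (2 * (norm (y - z) * K))"
      using c K by (intro mult_left_mono) auto
    also have "\<dots> = 2 * K * K * c * norm (y - z)" by (simp add: mult_ac)
    also have "\<dots> \<le> e * norm (y - z)" using c by (intro mult_right_mono) auto
    finally show "norm (g y - g z - f'i (y - z)) \<le> e * norm (y - z)" using 2 by linarith
  qed
qed

section \<open>Invariance of the paratingent and regular tangent cones\<close>

lemma paratingent_cone_image:
  assumes f: "has_strict_derivative f f' a"
    and loc: "\<forall>\<^sub>F z in nhds a. z \<in> A \<longrightarrow> f z \<in> B"
    and w: "w \<in> paratingent_cone A a"
  shows "f' w \<in> paratingent_cone B (f a)"
proof -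
  obtain t z q where *: "t \<longlonglongrightarrow> 0" "\<forall>\<^sub>F k in sequentially. 0 < t k"
        "z \<longlonglongrightarrow> a" "\<forall>\<^sub>F k in sequentially. z k \<in> A"
        "q \<longlonglongrightarrow> w" "\<forall>\<^sub>F k in sequentially. z k + t k *\<^sub>R q k \<in> A"
    using w unfolding paratingent_cone_iff by blast
  have y: "(\<lambda>k. z k + t k *\<^sub>R q k) \<longlonglongrightarrow> a"
    using tendsto_add[OF *(3) tendsto_scaleR[OF *(1,5)]] by simp
  define r where "r k = (1 / t k) *\<^sub>R (f (z k + t k *\<^sub>R q k) - f (z k))" for k
  have "r \<longlonglongrightarrow> f' w"
    unfolding r_def by (rule has_strict_derivative_sequentially[OF f *(2,1,3,5)])
  moreover have "(\<lambda>k. f (z k)) \<longlonglongrightarrow> f a"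
    using isCont_tendsto_compose[OF has_strict_derivative_continuous[OF f] *(3)] .
  moreover have "\<forall>\<^sub>F k in sequentially. f (z k) \<in> B"
    using *(4) eventually_compose_filterlim[OF loc *(3)] by eventually_elim simp
  moreover have "\<forall>\<^sub>F k in sequentially. f (z k) + t k *\<^sub>R r k \<in> B"
    using *(2,6) eventually_compose_filterlim[OF loc y] by eventually_elim (simp add: r_def)
  ultimately show ?thesis unfolding paratingent_cone_iff using *(1,2) by blast
qed

text \<open>An inner limit must answer every sequence of base points in \<open>B\<close>. The local
  right inverse \<open>g\<close> moves such a sequence into \<open>A\<close>, where \<open>w\<close>
  has an answer that \<open>f\<close> carries back.\<close>

lemma regular_tangent_cone_image:
  assumes f: "has_strict_derivative f f' a"
    and loc: "\<forall>\<^sub>F z in nhds a. z \<in> A \<longrightarrow> f z \<in> B"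
    and g: "isCont g (f a)" "g (f a) = a" "\<forall>\<^sub>F y in nhds (f a). y \<in> B \<longrightarrow> g y \<in> A \<and> f (g y) = y"
    and w: "w \<in> regular_tangent_cone A a"
  shows "f' w \<in> regular_tangent_cone B (f a)"
  unfolding regular_tangent_cone_iff
proof (intro allI impI)
  fix t :: "nat \<Rightarrow> real" and y
  assume *: "t \<longlonglongrightarrow> 0" "\<forall>\<^sub>F k in sequentially. 0 < t k"
    "y \<longlonglongrightarrow> f a" "\<forall>\<^sub>F k in sequentially. y k \<in> B"
  have z: "(\<lambda>k. g (y k)) \<longlonglongrightarrow> a"
    using isCont_tendsto_compose[OF g(1) *(3)] g(2) by simp
  have yB: "\<forall>\<^sub>F k in sequentially. g (y k) \<in> A \<and> f (g (y k)) = y k"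
    using *(4) eventually_compose_filterlim[OF g(3) *(3)] by eventually_elim simp
  then have zA: "\<forall>\<^sub>F k in sequentially. g (y k) \<in> A" by eventually_elim simp
  obtain q where q: "q \<longlonglongrightarrow> w" "\<forall>\<^sub>F k in sequentially. g (y k) + t k *\<^sub>R q k \<in> A"
    using w[unfolded regular_tangent_cone_iff, rule_format, OF *(1,2) z zA] by blast
  have x: "(\<lambda>k. g (y k) + t k *\<^sub>R q k) \<longlonglongrightarrow> a"
    using tendsto_add[OF z tendsto_scaleR[OF *(1) q(1)]] by simp
  define r where "r k = (1 / t k) *\<^sub>R (f (g (y k) + t k *\<^sub>R q k) - f (g (y k)))" for k
  have "r \<longlonglongrightarrow> f' w"
    unfolding r_def by (rule has_strict_derivative_sequentially[OF f *(2,1) z q(1)])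
  moreover have "\<forall>\<^sub>F k in sequentially. y k + t k *\<^sub>R r k \<in> B"
    using *(2) q(2) yB eventually_compose_filterlim[OF loc x] by eventually_elim (simp add: r_def)
  ultimately show "\<exists>q. q \<longlonglongrightarrow> f' w \<and> (\<forall>\<^sub>F k in sequentially. y k + t k *\<^sub>R q k \<in> B)"
    by blast
qed

text \<open>The bijection \<open>f'\<close> matches each of the two cones of \<open>A\<close> with
  that of \<open>B\<close>, by the image lemmas for \<open>f\<close> and for its strictly
  differentiable inverse; so it preserves their equality.\<close>

lemma tangent_cones_eq_homeomorphism:
  fixes f :: "'a::real_normed_vector \<Rightarrow> 'b::real_normed_vector"
  assumes f: "has_strict_derivative f f' a"
    and inv: "bounded_linear f'i" "\<And>u. f'i (f' u) = u" "\<And>u. f' (f'i u) = u"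
    and hom: "homeomorphism U V f g" and op: "open U" "open V" and a: "a \<in> U" "a \<in> A"
    and eq: "\<And>z. z \<in> U \<Longrightarrow> z \<in> A \<longleftrightarrow> f z \<in> B"
  shows "paratingent_cone A a = regular_tangent_cone A a \<longleftrightarrow>
    paratingent_cone B (f a) = regular_tangent_cone B (f a)"
proof -
  have fa: "f a \<in> V" "g (f a) = a" "f a \<in> B"
    using hom a eq by (auto simp: homeomorphism_def)
  have gc: "isCont g (f a)" and fc: "isCont f (g (f a))"
    using hom op fa a by (auto simp: homeomorphism_def continuous_on_eq_continuous_at)
  have evU: "\<forall>\<^sub>F z in nhds a. z \<in> U" and evV: "\<forall>\<^sub>F y in nhds (f a). y \<in> V"
    using eventually_nhds_in_open op a fa by auto
  have l1: "\<forall>\<^sub>F z in nhds a. z \<in> A \<longrightarrow> f z \<in> B"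
    using evU by eventually_elim (use eq in auto)
  have l2: "\<forall>\<^sub>F y in nhds (f a). y \<in> B \<longrightarrow> g y \<in> A \<and> f (g y) = y"
    using evV by eventually_elim (use eq hom in \<open>force simp: homeomorphism_def\<close>)
  have l3: "\<forall>\<^sub>F y in nhds (f a). f (g y) = y"
    using evV by eventually_elim (use hom in \<open>auto simp: homeomorphism_def\<close>)
  have l4: "\<forall>\<^sub>F y in nhds (f a). y \<in> B \<longrightarrow> g y \<in> A"
    using l2 by eventually_elim simp
  have l5: "\<forall>\<^sub>F z in nhds (g (f a)). z \<in> A \<longrightarrow> f z \<in> B \<and> g (f z) = z"
    unfolding fa(2) using evU by eventually_elim (use eq hom in \<open>auto simp: homeomorphism_def\<close>)
  have g: "has_strict_derivative g f'i (f a)"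
    by (rule has_strict_derivative_inverse[OF f inv gc fa(2) l3])
  have P: "w \<in> paratingent_cone A a \<longleftrightarrow> f' w \<in> paratingent_cone B (f a)" for w
    using paratingent_cone_image[OF f l1, of w] paratingent_cone_image[OF g l4, of "f' w"]
    by (auto simp: inv fa)
  have R: "w \<in> regular_tangent_cone A a \<longleftrightarrow> f' w \<in> regular_tangent_cone B (f a)" for w
    using regular_tangent_cone_image[OF f l1 gc fa(2) l2, of w]
      regular_tangent_cone_image[OF g l4 fc _ l5, of "f' w"]
    by (auto simp: inv fa)
  show ?thesis
    unfolding set_eq_iff P R using inv(3) by metis
qed


section \<open>Normal cones of a convex set\<close>

text \<open>Both cones equal \<open>Z\<close>: difference quotients of points of \<open>Z\<close>
  stay in the closed set \<open>Z\<close>, and each \<open>w\<close> in \<open>Z\<close> answers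
  every base sequence as a constant quotient.\<close>

lemma tangent_cones_locally_subspace:
  fixes Z :: "'a::euclidean_space set"
  assumes Z: "subspace Z" and x: "x \<in> S" and loc: "\<forall>\<^sub>F z in nhds x. z \<in> S \<longleftrightarrow> z \<in> Z"
  shows "paratingent_cone S x = regular_tangent_cone S x"
proof
  show "regular_tangent_cone S x \<subseteq> paratingent_cone S x"
    by (rule regular_tangent_cone_subset_paratingent_cone[OF x])
  show "paratingent_cone S x \<subseteq> regular_tangent_cone S x"
  proof
    fix w assume "w \<in> paratingent_cone S x"
    then obtain t z q where *: "t \<longlonglongrightarrow> 0" "\<forall>\<^sub>F k in sequentially. 0 < t k"
        "z \<longlonglongrightarrow> x" "\<forall>\<^sub>F k in sequentially. z k \<in> S"
        "q \<longlonglongrightarrow> w" "\<forall>\<^sub>F k in sequentially. z k + t k *\<^sub>R q k \<in> S"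
      unfolding paratingent_cone_iff by blast
    have "(\<lambda>k. z k + t k *\<^sub>R q k) \<longlonglongrightarrow> x"
      using tendsto_add[OF *(3) tendsto_scaleR[OF *(1,5)]] by simp
    from eventually_compose_filterlim[OF loc this] eventually_compose_filterlim[OF loc *(3)] *(2,4,6)
    have "\<forall>\<^sub>F k in sequentially. q k \<in> Z"
    proof eventually_elim
      case (elim k)
      then have "(1 / t k) *\<^sub>R ((z k + t k *\<^sub>R q k) - z k) \<in> Z"
        using Z by (intro subspace_scale subspace_diff) auto
      with elim show ?case by simp
    qed
    from Lim_in_closed_set[OF closed_subspace[OF Z] this _ *(5)] have w: "w \<in> Z" by simp
    show "w \<in> regular_tangent_cone S x"
      unfolding regular_tangent_cone_iff
    proof (intro allI impI)
      fix t :: "nat \<Rightarrow> real" and z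
      assume *: "t \<longlonglongrightarrow> 0" "\<forall>\<^sub>F k in sequentially. 0 < t k"
        "z \<longlonglongrightarrow> x" "\<forall>\<^sub>F k in sequentially. z k \<in> S"
      have "(\<lambda>k. z k + t k *\<^sub>R w) \<longlonglongrightarrow> x"
        using tendsto_add[OF *(3) tendsto_scaleR[OF *(1) tendsto_const]] by simp
      from eventually_compose_filterlim[OF loc this] eventually_compose_filterlim[OF loc *(3)] *(4)
      have "\<forall>\<^sub>F k in sequentially. z k + t k *\<^sub>R w \<in> S"
        by eventually_elim (use w Z in \<open>auto intro: subspace_add subspace_scale\<close>)
      then show "\<exists>q. q \<longlonglongrightarrow> w \<and> (\<forall>\<^sub>F k in sequentially. z k + t k *\<^sub>R q k \<in> S)"
        by (intro exI[of _ "\<lambda>_. w"]) simp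
    qed
  qed
qed

text \<open>
  For a closed convex set \<open>D\<close> this is the graph of the subdifferential of its support function.
\<close>

definition inverse_normal_graph :: "'a::real_inner set \<Rightarrow> ('a \<times> 'a) set" where
  "inverse_normal_graph D = {(y, \<mu>). \<mu> \<in> D \<and> (\<forall>\<nu>\<in>D. (\<nu> - \<mu>) \<bullet> y \<le> 0)}"

text \<open>For small \<open>\<mu>\<close> the relative interior leaves room to move in both signs
  of each direction in \<open>span D\<close>, so the normality inequalities become orthogonality,
  whatever \<open>y\<close> is.\<close>

lemma inverse_normal_graph_tangent_cones_eq:
  fixes D :: "'a::euclidean_space set"
  assumes "0 \<in> rel_interior D"
  obtains e where "e > 0" "\<And>y \<mu>. (y, \<mu>) \<in> inverse_normal_graph D \<Longrightarrow> norm \<mu> < e \<Longrightarrow>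
    paratingent_cone (inverse_normal_graph D) (y, \<mu>) = regular_tangent_cone (inverse_normal_graph D) (y, \<mu>)"
proof -
  obtain e where e: "e > 0" "0 \<in> D" and "ball 0 e \<inter> affine hull D \<subseteq> D"
    using assms by (auto simp: mem_rel_interior_ball)
  then have ball: "\<mu> \<in> D" if "norm \<mu> < e" "\<mu> \<in> span D" for \<mu>
    using that hull_inc[of 0 D affine] by (auto simp: affine_hull_span_0)
  \<comment> \<open>The product of the orthogonal complement of \<open>D\<close> with
    \<open>span D\<close>.\<close>
  define Z where "Z = (\<Inter>\<nu>\<in>D. {z. \<nu> \<bullet> fst z = 0}) \<inter> {z. snd z \<in> span D}"
  have "subspace Z"
    unfolding Z_def subspace_def
    by (auto simp: inner_add_right intro: span_add span_scale span_zero)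
  have eq: "(y, \<mu>) \<in> inverse_normal_graph D \<longleftrightarrow> (y, \<mu>) \<in> Z" if \<mu>: "norm \<mu> < e" for y \<mu>
  proof
    assume S: "(y, \<mu>) \<in> inverse_normal_graph D"
    then have "\<mu> \<in> D" by (simp add: inverse_normal_graph_def)
    have le: "d \<bullet> y \<le> 0" if d: "d \<in> span D" for d
    proof -
      \<comment> \<open>The step is short enough to keep \<open>\<mu> + s *\<^sub>R d\<close> in the
        ball of radius \<open>e\<close>; the summand 1 in the denominator guards against
        \<open>d = 0\<close>.\<close>
      obtain s where s: "s > 0" "s * norm d < e - norm \<mu>"
      proof
        have pos: "norm d + 1 > 0" by (simp add: add_nonneg_pos)
        then show "(e - norm \<mu>) / (norm d + 1) > 0" using \<mu> by simp
        have "(e - norm \<mu>) * norm d < (e - norm \<mu>) * (norm d + 1)"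
          using \<mu> by (intro mult_strict_left_mono) auto
        then show "(e - norm \<mu>) / (norm d + 1) * norm d < e - norm \<mu>"
          using pos by (simp add: divide_less_eq)
      qed
      have "norm (s *\<^sub>R d) = s * norm d" using s by simp
      then have "norm (\<mu> + s *\<^sub>R d) < e"
        using norm_triangle_ineq[of \<mu> "s *\<^sub>R d"] s by linarith
      then have "\<mu> + s *\<^sub>R d \<in> D"
        by (rule ball) (use d \<open>\<mu> \<in> D\<close> in \<open>auto intro: span_add span_scale span_base\<close>)
      then have "(\<mu> + s *\<^sub>R d - \<mu>) \<bullet> y \<le> 0"
        using S unfolding inverse_normal_graph_def by blast
      then show ?thesis using s by (simp add: mult_le_0_iff)
    qed
    have "\<nu> \<bullet> y = 0" if "\<nu> \<in> D" for \<nu>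
      using le[of \<nu>] le[of "- \<nu>"] span_base[OF that] span_neg[of \<nu> D] by simp
    then show "(y, \<mu>) \<in> Z" using \<open>\<mu> \<in> D\<close> by (auto simp: Z_def span_base)
  next
    assume Z: "(y, \<mu>) \<in> Z"
    have "D \<subseteq> {\<nu>. \<nu> \<bullet> y = 0}" using Z by (auto simp: Z_def)
    then have "span D \<subseteq> {\<nu>. \<nu> \<bullet> y = 0}"
      by (rule span_minimal) (auto simp: subspace_def inner_add_left)
    then show "(y, \<mu>) \<in> inverse_normal_graph D"
      using Z ball[OF \<mu>] by (auto simp: Z_def inverse_normal_graph_def inner_diff_left)
  qed
  have "paratingent_cone (inverse_normal_graph D) (y, \<mu>) = regular_tangent_cone (inverse_normal_graph D) (y, \<mu>)"
    if "(y, \<mu>) \<in> inverse_normal_graph D" "norm \<mu> < e" for y \<mu>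
  proof (rule tangent_cones_locally_subspace[OF \<open>subspace Z\<close> that(1)])
    have "open {z :: 'a \<times> 'a. norm (snd z) < e}"
      by (intro open_Collect_less continuous_intros)
    from eventually_nhds_in_open[OF this, of "(y, \<mu>)"] that(2)
    show "\<forall>\<^sub>F z in nhds (y, \<mu>). z \<in> inverse_normal_graph D \<longleftrightarrow> z \<in> Z"
      by (auto elim!: eventually_mono simp: eq)
  qed
  with e(1) that show ?thesis by blast
qed

text \<open>
  The paratingent cone is symmetric about the base point, so equality of the two cones turns every
  normal direction of \<open>D\<close> at the origin into a pair of opposite ones.
\<close>

lemma zero_in_rel_interior_if_tangent_cones_eq:
  fixes D :: "'a::euclidean_space set"
  assumes D: "convex D" "0 \<in> D"
    and eq: "paratingent_cone (inverse_normal_graph D) (0, 0) = regular_tangent_cone (inverse_normal_graph D) (0, 0)"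
  shows "0 \<in> rel_interior D"
proof (rule ccontr)
  assume "0 \<notin> rel_interior D"
  then obtain a where a: "\<And>\<mu>. \<mu> \<in> D \<Longrightarrow> a \<bullet> 0 \<le> a \<bullet> \<mu>" "\<And>\<mu>. \<mu> \<in> rel_interior D \<Longrightarrow> a \<bullet> 0 < a \<bullet> \<mu>"
    using supporting_hyperplane_rel_boundary[OF D] by metis
  obtain \<mu> where \<mu>: "\<mu> \<in> rel_interior D"
    using rel_interior_eq_empty[OF D(1)] D(2) by blast
  let ?S = "inverse_normal_graph D"
  let ?t = "\<lambda>k. inverse (real (Suc k))"
  \<comment> \<open>Since \<open>a\<close> is nonnegative on \<open>D\<close>, it is
    \<open>- a\<close> that is normal to \<open>D\<close> at the origin.\<close>
  have ray: "(?t k *\<^sub>R (- a), 0) \<in> ?S" for k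
    using a(1) D(2) by (simp add: inverse_normal_graph_def inner_commute)
  have zero: "(0, 0) \<in> ?S" using D(2) by (simp add: inverse_normal_graph_def)
  have "(\<lambda>k. (?t k *\<^sub>R (- a), 0)) \<longlonglongrightarrow> (0 *\<^sub>R (- a), 0)"
    by (intro tendsto_intros LIMSEQ_inverse_real_of_nat)
  \<comment> \<open>Start at \<open>- t a\<close> and step \<open>t\<close> in direction
    \<open>a\<close>: the endpoint is the origin. Moving base points thus make the reversed
    direction paratingent.\<close>
  then have "(a, 0) \<in> paratingent_cone ?S (0, 0)"
    unfolding paratingent_cone_iff using LIMSEQ_inverse_real_of_nat ray zero
    by (intro exI[of _ ?t] exI[of _ "\<lambda>k. (?t k *\<^sub>R (- a), 0)"] exI[of _ "\<lambda>k. (a, 0)"])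
      (simp add: zero_prod_def)
  then have "(a, 0) \<in> regular_tangent_cone ?S (0, 0)" using eq by simp
  from this[unfolded regular_tangent_cone_iff, rule_format, OF LIMSEQ_inverse_real_of_nat _ tendsto_const]
  obtain q where q: "q \<longlonglongrightarrow> (a, 0)"
    "\<forall>\<^sub>F k in sequentially. (0, 0) + ?t k *\<^sub>R q k \<in> ?S"
    using zero by auto
  have q1: "(\<lambda>k. fst (q k)) \<longlonglongrightarrow> a" "(\<lambda>k. snd (q k)) \<longlonglongrightarrow> 0"
    using tendsto_fst[OF q(1)] tendsto_snd[OF q(1)] by simp_all
  \<comment> \<open>Testing the graph points against the relative interior point
    \<open>\<mu>\<close> gives \<open>\<mu> \<bullet> a \<le> 0\<close> in the limit, against strict
    separation.\<close>
  have "(\<lambda>k. (\<mu> - ?t k *\<^sub>R snd (q k)) \<bullet> fst (q k)) \<longlonglongrightarrow> (\<mu> - 0 *\<^sub>R 0) \<bullet> a"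
    by (intro tendsto_intros q1 LIMSEQ_inverse_real_of_nat)
  moreover have "\<forall>\<^sub>F k in sequentially. (\<mu> - ?t k *\<^sub>R snd (q k)) \<bullet> fst (q k) \<le> 0"
    using q(2)
  proof eventually_elim
    case (elim k)
    have "\<mu> \<in> D" using \<mu> rel_interior_subset by blast
    moreover have "(?t k *\<^sub>R fst (q k), ?t k *\<^sub>R snd (q k)) \<in> ?S"
      using elim by (simp add: scaleR_prod_def)
    ultimately have "(\<mu> - ?t k *\<^sub>R snd (q k)) \<bullet> (?t k *\<^sub>R fst (q k)) \<le> 0"
      unfolding inverse_normal_graph_def by blast
    then have "?t k * ((\<mu> - ?t k *\<^sub>R snd (q k)) \<bullet> fst (q k)) \<le> 0" by simp
    then show ?case by (simp only: mult_le_0_iff) (simp add: order.strict_iff_not[of 0])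
  qed
  ultimately have "(\<mu> - 0 *\<^sub>R 0) \<bullet> a \<le> 0"
    by (rule tendsto_upperbound) simp
  then show False using a(2)[OF \<mu>] by (simp add: inner_commute)
qed

section \<open>Sublinear functions given by homogeneous constraints\<close>

definition epi_cone :: "('a::real_inner \<times> real) set \<Rightarrow> ('a \<times> real) set" where
  "epi_cone B = {(y, s). \<forall>(b, \<sigma>)\<in>B. b \<bullet> y \<le> \<sigma> * s}"

text \<open>If \<open>Q\<close> is the epigraph of a closed sublinear function \<open>p\<close>,
  this is the subdifferential of \<open>p\<close> at the origin, the set whose support function is
  \<open>p\<close>. In \<open>epi_cone B\<close>, pairs with \<open>\<sigma> > 0\<close> bound the
  height from below and pairs with \<open>\<sigma> = 0\<close> restrict the domain.\<close>

definition dual_section :: "('a::real_inner \<times> real) set \<Rightarrow> 'a set" where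
  "dual_section Q = {\<mu>. \<forall>(y, s)\<in>Q. \<mu> \<bullet> y \<le> s}"

lemma convex_dual_section: "convex (dual_section Q)"
proof (rule convexI)
  fix \<mu> \<nu> and u v :: real
  assume *: "\<mu> \<in> dual_section Q" "\<nu> \<in> dual_section Q" "0 \<le> u" "0 \<le> v" "u + v = 1"
  show "u *\<^sub>R \<mu> + v *\<^sub>R \<nu> \<in> dual_section Q"
    unfolding dual_section_def
  proof (safe)
    fix y s assume "(y, s) \<in> Q"
    then have "u * (\<mu> \<bullet> y) + v * (\<nu> \<bullet> y) \<le> u * s + v * s"
      using * by (intro add_mono mult_left_mono) (auto simp: dual_section_def)
    also have "\<dots> = s" using * by (simp flip: distrib_right)
    finally show "(u *\<^sub>R \<mu> + v *\<^sub>R \<nu>) \<bullet> y \<le> s" by (simp add: inner_add_left)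
  qed
qed

lemma epi_cone_scale: "(y, s) \<in> epi_cone B \<Longrightarrow> 0 \<le> c \<Longrightarrow> (c *\<^sub>R y, c * s) \<in> epi_cone B"
  unfolding epi_cone_def by (auto simp: mult.left_commute[of \<sigma> c for \<sigma>] intro!: mult_left_mono)

lemma convex_epi_cone: "convex (epi_cone B)"
proof -
  have "epi_cone B = (\<Inter>(b, \<sigma>)\<in>B. {z. (b, - \<sigma>) \<bullet> z \<le> 0})"
    by (auto simp: epi_cone_def)
  then show ?thesis by (auto intro!: convex_INT simp: convex_halfspace_le)
qed

text \<open>Subgradients of a support function are the maximizers over \<open>D\<close>. For the
  converse no separation argument is made: each constraint in \<open>B\<close> itself produces an
  element of \<open>D\<close> against which maximality of \<open>\<mu>\<close> is tested.\<close>

lemma limiting_normal_cone_epi_cone: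
  assumes nonneg: "\<And>b \<sigma>. (b, \<sigma>) \<in> B \<Longrightarrow> 0 \<le> \<sigma>"
  defines "D \<equiv> dual_section (epi_cone B)"
  shows "(y, s) \<in> epi_cone B \<and> (\<mu>, -1) \<in> limiting_normal_cone (epi_cone B) (y, s) \<longleftrightarrow>
    (y, \<mu>) \<in> inverse_normal_graph D \<and> s = \<mu> \<bullet> y" (is "?L \<longleftrightarrow> ?R")
proof
  assume L: ?L
  then have Q: "(y, s) \<in> epi_cone B" and "(\<mu>, -1) \<in> limiting_normal_cone (epi_cone B) (y, s)" by auto
  then have N: "\<mu> \<bullet> (y' - y) \<le> s' - s" if "(y', s') \<in> epi_cone B" for y' s'
    using that unfolding limiting_normal_cone_convex[OF convex_epi_cone Q] by auto
  \<comment> \<open>Stretching the base point by 2 gives \<open>\<mu> \<bullet> y \<le> s\<close>;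
    shrinking it to 0 gives the reverse.\<close>
  have s: "s = \<mu> \<bullet> y"
    using N[OF epi_cone_scale[OF Q, of 2]] N[OF epi_cone_scale[OF Q, of 0]]
    by (simp add: inner_diff_right)
  have "\<mu> \<in> D" using N s by (force simp: D_def dual_section_def inner_diff_right)
  moreover have "\<nu> \<bullet> y \<le> s" if "\<nu> \<in> D" for \<nu>
    using that Q by (auto simp: D_def dual_section_def)
  ultimately show ?R using s by (auto simp: inverse_normal_graph_def inner_diff_left)
next
  assume R: ?R
  then have \<mu>: "\<mu> \<in> D" and y: "\<And>\<nu>. \<nu> \<in> D \<Longrightarrow> \<nu> \<bullet> y \<le> \<mu> \<bullet> y" and s: "s = \<mu> \<bullet> y"
    by (auto simp: inverse_normal_graph_def inner_diff_left)
  \<comment> \<open>For \<open>\<sigma> = 0\<close> the normal \<open>b\<close> is a recession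
    direction of \<open>D\<close>, tested as \<open>\<mu> + b\<close>; for
    \<open>\<sigma> > 0\<close> the normalized \<open>b / \<sigma>\<close> lies in
    \<open>D\<close>.\<close>
  have "b \<bullet> y \<le> \<sigma> * s" if b: "(b, \<sigma>) \<in> B" for b \<sigma>
  proof (cases "\<sigma> = 0")
    case True
    have "\<mu> + b \<in> D"
      unfolding D_def dual_section_def
    proof safe
      fix y' s' assume "(y', s') \<in> epi_cone B"
      with \<mu> b True show "(\<mu> + b) \<bullet> y' \<le> s'"
        by (fastforce simp: epi_cone_def D_def dual_section_def inner_add_left)
    qed
    from y[OF this] True show ?thesis by (simp add: inner_add_left)
  next
    case False
    with nonneg[OF b] have "\<sigma> > 0" by simp
    then have "(1 / \<sigma>) *\<^sub>R b \<in> D"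
      using b by (fastforce simp: epi_cone_def D_def dual_section_def field_simps)
    from y[OF this] \<open>\<sigma> > 0\<close> show ?thesis by (simp add: s field_simps)
  qed
  then have Q: "(y, s) \<in> epi_cone B" by (auto simp: epi_cone_def)
  moreover have "(\<mu>, -1) \<in> limiting_normal_cone (epi_cone B) (y, s)"
    unfolding limiting_normal_cone_convex[OF convex_epi_cone Q]
    using \<mu> s by (auto simp: D_def dual_section_def inner_diff_right)
  ultimately show ?L by simp
qed

text \<open>The lower bound \<open>c\<close> for \<open>T x\<close> persists as \<open>c / 2\<close>
  nearby. With \<open>v = inv (T x) u\<close>, applying \<open>T z\<close> to the difference of the
  inverses at \<open>u\<close> gives \<open>T x v - T z v\<close>, which tends to 0.\<close>

lemma continuous_on_inv_linear:
  fixes T :: "'c::t2_space \<Rightarrow> 'a::euclidean_space \<Rightarrow> 'a"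
  assumes op: "open W" and cont: "\<And>u. continuous_on W (\<lambda>x. T x u)"
    and lin: "\<And>x. x \<in> W \<Longrightarrow> linear (T x)" and bij: "\<And>x. x \<in> W \<Longrightarrow> bij (T x)"
  shows "continuous_on W (\<lambda>x. inv (T x) u)"
  unfolding continuous_on_eq_continuous_at[OF op]
proof
  fix x assume x: "x \<in> W"
  interpret x: linear "T x" by (rule lin[OF x])
  obtain c where c: "c > 0" "\<And>u. c * norm u \<le> norm (T x u)"
    using linear_inj_bounded_below_pos[OF lin[OF x] bij_is_inj[OF bij[OF x]]] by metis
  define B where "B z = (\<Sum>b\<in>Basis. norm (T z b - T x b))" for z
  have cx: "isCont (\<lambda>z. T z u) x" for u
    using cont op x by (auto simp: continuous_on_eq_continuous_at)
  have "isCont B x"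
    unfolding B_def by (intro continuous_intros cx)
  then have "\<forall>\<^sub>F z in at x. B z < c / 2"
    using c order_tendstoD(2)[of B "B x" "at x" "c / 2"] by (simp add: B_def isCont_def)
  moreover have "\<forall>\<^sub>F z in at x. z \<in> W" using op x by (rule eventually_at_in_open')
  ultimately have ev: "\<forall>\<^sub>F z in at x. norm (inv (T z) u - inv (T x) u) \<le>
      2 / c * norm (T x (inv (T x) u) - T z (inv (T x) u))"
  proof eventually_elim
    case (elim z)
    interpret z: linear "T z" using lin elim by blast
    have low: "c / 2 * norm v \<le> norm (T z v)" for v
    proof -
      have "T z v - T x v = (\<Sum>b\<in>Basis. (v \<bullet> b) *\<^sub>R (T z b - T x b))"
        by (subst (1 2) euclidean_representation[of v, symmetric])
          (simp add: z.sum x.sum z.scaleR x.scaleR sum_subtractf scaleR_diff_right)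
      also have "norm \<dots> \<le> (\<Sum>b\<in>Basis. norm v * norm (T z b - T x b))"
        by (intro sum_norm_le) (simp add: Basis_le_norm mult_right_mono)
      also have "\<dots> = B z * norm v" by (simp add: B_def sum_distrib_left mult.commute)
      also have "\<dots> \<le> c / 2 * norm v" using elim by (intro mult_right_mono) auto
      finally show ?thesis
        using c(2)[of v] norm_triangle_ineq2[of "T x v" "T z v"] by (simp add: norm_minus_commute)
    qed
    have inv: "T z (inv (T z) u) = u" "T x (inv (T x) u) = u"
      using bij elim x by (simp_all add: bij_is_surj surj_f_inv_f)
    have "c / 2 * norm (inv (T z) u - inv (T x) u) \<le> norm (T z (inv (T z) u - inv (T x) u))"
      by (rule low)
    also have "\<dots> = norm (T x (inv (T x) u) - T z (inv (T x) u))"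
      by (simp add: z.diff inv)
    finally show ?case using c by (simp add: field_simps)
  qed
  have "(\<lambda>z. 2 / c * norm (T x (inv (T x) u) - T z (inv (T x) u))) \<midarrow>x\<rightarrow>
      2 / c * norm (T x (inv (T x) u) - T x (inv (T x) u))"
    using cx by (intro tendsto_intros) (simp add: isCont_def)
  then have "(\<lambda>z. inv (T z) u - inv (T x) u) \<midarrow>x\<rightarrow> 0"
    by (intro Lim_null_comparison[OF ev]) simp
  then show "isCont (\<lambda>x. inv (T x) u) x"
    by (simp add: isCont_def LIM_zero_iff)
qed

lemma continuous_on_adjoint:
  fixes T :: "'c::topological_space \<Rightarrow> 'a::euclidean_space \<Rightarrow> 'b::euclidean_space"
  assumes "\<And>u. continuous_on S (\<lambda>z. T z u)" "\<And>z. z \<in> S \<Longrightarrow> linear (T z)" "continuous_on S v"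
  shows "continuous_on S (\<lambda>z. adjoint (T z) (v z))"
  unfolding continuous_on_def
proof
  fix x assume x: "x \<in> S"
  have "\<forall>\<^sub>F z in at x within S. linear (T z)"
    using assms(2) by (auto simp: eventually_at_filter)
  then show "((\<lambda>z. adjoint (T z) (v z)) \<longlongrightarrow> adjoint (T x) (v x)) (at x within S)"
    using assms x by (intro tendsto_adjoint) (auto simp: continuous_on_def)
qed

lemma adjoint_left_inverse:
  fixes f :: "'a::euclidean_space \<Rightarrow> 'b::euclidean_space"
  assumes "linear f" "linear g" "\<And>u. g (f u) = u"
  shows "adjoint f (adjoint g v) = v"
proof (rule vector_eq_ldot[THEN iffD1], rule allI)
  fix u
  show "u \<bullet> adjoint f (adjoint g v) = u \<bullet> v"
    using assms by (simp add: adjoint_works)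
qed


section \<open>Epigraphs straightened by a change of coordinates\<close>

lemma ereal_eq_if_epi:
  assumes "a \<le> ereal c" "\<And>r. a \<le> ereal r \<Longrightarrow> c \<le> r"
  shows "a = ereal c"
proof (cases a)
  case (real r)
  with assms(1) assms(2)[of r] show ?thesis by simp
next
  case PInf
  with assms(1) show ?thesis by simp
next
  case MInf
  with assms(2)[of "c - 1"] show ?thesis by simp
qed

lemma adjoint_eqI:
  fixes f :: "'a::euclidean_space \<Rightarrow> 'b::euclidean_space"
  assumes "\<And>u. f u \<bullet> w = u \<bullet> g"
    and "linear f"
  shows "adjoint f w = g"
  by (rule vector_eq_ldot[THEN iffD1]) (simp add: adjoint_works assms)

lemma mem_epi: "(x, r) \<in> epi f \<longleftrightarrow> f x \<le> ereal r"
  by (simp add: epi_def)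

lemma has_derivative_compose_fst:
  assumes "(g has_derivative g') (at (fst z))"
  shows "((\<lambda>z. g (fst z)) has_derivative (\<lambda>u. g' (fst u))) (at z)"
  by (rule has_derivative_compose[OF has_derivative_fst[OF has_derivative_ident] assms])

text \<open>This encodes \<open>\<phi> = f + p \<circ> \<Theta>\<close> on \<open>W\<close>, with
  \<open>epi_cone B\<close> the epigraph of \<open>p\<close>; speaking of epigraphs avoids
  arithmetic with infinite values. \<open>P\<close> is the derivative of the parametrization of
  subgradients, and \<open>P_snd\<close> makes it invertible in the multiplier.\<close>

locale straightened_epigraph =
  fixes \<phi> :: "'a::euclidean_space \<Rightarrow> ereal"
    and f :: "'a \<Rightarrow> real" and F :: "'a \<Rightarrow> 'a"
    and \<Theta> \<Theta>i :: "'a \<Rightarrow> 'a" and \<Theta>' :: "'a \<Rightarrow> 'a \<Rightarrow> 'a" and W V :: "'a set"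
    and P :: "'a \<times> 'a \<Rightarrow> 'a \<times> 'a \<Rightarrow> 'a" and B :: "('a \<times> real) set"
  assumes hom: "homeomorphism W V \<Theta> \<Theta>i" and op: "open W" "open V"
    and der\<Theta>: "x \<in> W \<Longrightarrow> (\<Theta> has_derivative \<Theta>' x) (at x)"
    and cont\<Theta>': "continuous_on W (\<lambda>x. \<Theta>' x u)"
    and bij: "x \<in> W \<Longrightarrow> bij (\<Theta>' x)"
    and der\<Theta>i: "y \<in> V \<Longrightarrow> (\<Theta>i has_derivative inv (\<Theta>' (\<Theta>i y))) (at y)"
    and derf: "x \<in> W \<Longrightarrow> (f has_derivative (\<lambda>u. F x \<bullet> u)) (at x)"
    and contF: "continuous_on W F"
    and derP: "x \<in> W \<Longrightarrow> ((\<lambda>z. F (fst z) + adjoint (\<Theta>' (fst z)) (snd z)) has_derivative P (x, \<mu>)) (at (x, \<mu>))"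
    and contP: "continuous_on (W \<times> UNIV) (\<lambda>z. P z w)"
    and P_snd: "x \<in> W \<Longrightarrow> P (x, \<mu>) (0, \<nu>) = adjoint (\<Theta>' x) \<nu>"
    and nonneg: "(b, \<sigma>) \<in> B \<Longrightarrow> 0 \<le> \<sigma>"
    and epi_iff: "x \<in> W \<Longrightarrow> (x, r) \<in> epi \<phi> \<longleftrightarrow> (\<Theta> x, r - f x) \<in> epi_cone B"
begin

definition "D = dual_section (epi_cone B)"

lemma maps: "x \<in> W \<Longrightarrow> \<Theta> x \<in> V" "y \<in> V \<Longrightarrow> \<Theta>i y \<in> W" "x \<in> W \<Longrightarrow> \<Theta>i (\<Theta> x) = x" "y \<in> V \<Longrightarrow> \<Theta> (\<Theta>i y) = y"
  and cont\<Theta>: "continuous_on W \<Theta>" and cont\<Theta>i: "continuous_on V \<Theta>i"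
  using hom by (auto simp: homeomorphism_def)

lemma linear\<Theta>': "x \<in> W \<Longrightarrow> linear (\<Theta>' x)"
  using der\<Theta> has_derivative_linear by blast

lemma linear_inv: "x \<in> W \<Longrightarrow> linear (inv (\<Theta>' x))"
  using der\<Theta>i[of "\<Theta> x"] has_derivative_linear maps by fastforce

lemma inv_\<Theta>': "x \<in> W \<Longrightarrow> inv (\<Theta>' x) (\<Theta>' x u) = u" "x \<in> W \<Longrightarrow> \<Theta>' x (inv (\<Theta>' x) u) = u"
  using bij[of x] by (simp_all add: bij_is_inj bij_is_surj surj_f_inv_f)

lemma adjoint_inv:
  assumes "x \<in> W"
  shows "adjoint (\<Theta>' x) (adjoint (inv (\<Theta>' x)) u) = u" "adjoint (inv (\<Theta>' x)) (adjoint (\<Theta>' x) u) = u"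
  using assms by (simp_all add: adjoint_left_inverse linear\<Theta>' linear_inv inv_\<Theta>')

lemma cont_inv: "continuous_on W (\<lambda>x. inv (\<Theta>' x) u)"
  using op(1) cont\<Theta>' linear\<Theta>' bij by (rule continuous_on_inv_linear)

lemma contf: "continuous_on W f"
  using derf op by (auto simp: continuous_on_eq_continuous_at intro: has_derivative_continuous)

text \<open>The shear \<open>(x, r) \<mapsto> (\<Theta> x, r - f x)\<close> straightens the
  epigraph, and its adjoint preserves the component \<open>-1\<close>. Pulling normals back along it
  and along its inverse gives the two directions.\<close>

lemma limiting_normal_cone_epi:
  assumes x: "x \<in> W"
  shows "(\<mu>, -1) \<in> limiting_normal_cone (epi_cone B) (\<Theta> x, r - f x) \<longleftrightarrow>
    (F x + adjoint (\<Theta>' x) \<mu>, -1) \<in> limiting_normal_cone (epi \<phi>) (x, r)"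
proof -
  define H :: "'a \<times> real \<Rightarrow> 'a \<times> real" where "H z = (\<Theta> (fst z), snd z - f (fst z))" for z
  define H' :: "'a \<times> real \<Rightarrow> 'a \<times> real \<Rightarrow> 'a \<times> real"
    where "H' z = (\<lambda>u. (\<Theta>' (fst z) (fst u), snd u - F (fst z) \<bullet> fst u))" for z
  define G :: "'a \<times> real \<Rightarrow> 'a \<times> real" where "G y = (\<Theta>i (fst y), snd y + f (\<Theta>i (fst y)))" for y
  define G' :: "'a \<times> real \<Rightarrow> 'a \<times> real \<Rightarrow> 'a \<times> real"
    where "G' y = (\<lambda>u. (inv (\<Theta>' (\<Theta>i (fst y))) (fst u),
      snd u + F (\<Theta>i (fst y)) \<bullet> inv (\<Theta>' (\<Theta>i (fst y))) (fst u)))" for y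
  let ?U = "W \<times> (UNIV :: real set)" and ?V = "V \<times> (UNIV :: real set)"
  have opUV: "open ?U" "open ?V" using op by (auto intro: open_Times)
  have homH: "homeomorphism ?U ?V H G"
  proof (rule homeomorphismI)
    show "continuous_on ?U H"
      unfolding H_def
      by (intro continuous_intros continuous_on_compose2[OF cont\<Theta>] continuous_on_compose2[OF contf]) auto
    show "continuous_on ?V G"
      unfolding G_def
      by (intro continuous_intros continuous_on_compose2[OF cont\<Theta>i] continuous_on_compose2[OF contf]) (auto simp: maps)
  qed (auto simp: H_def G_def maps)
  have derH: "(H has_derivative H' z) (at z)" if "z \<in> ?U" for z
  proof -
    have "fst z \<in> W" using that by auto
    from has_derivative_compose_fst[OF der\<Theta>[OF this]] has_derivative_compose_fst[OF derf[OF this]]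
    show ?thesis
      unfolding H_def H'_def
      by (intro has_derivative_Pair has_derivative_diff has_derivative_snd has_derivative_ident)
  qed
  have derG: "(G has_derivative G' y) (at y)" if "y \<in> ?V" for y
  proof -
    have i: "((\<lambda>y. \<Theta>i (fst y)) has_derivative (\<lambda>u. inv (\<Theta>' (\<Theta>i (fst y))) (fst u))) (at y)"
      by (rule has_derivative_compose_fst[OF der\<Theta>i]) (use that in auto)
    have "((\<lambda>y. f (\<Theta>i (fst y))) has_derivative (\<lambda>u. F (\<Theta>i (fst y)) \<bullet> inv (\<Theta>' (\<Theta>i (fst y))) (fst u))) (at y)"
      using that maps by (auto intro!: has_derivative_compose[OF i derf])
    then show ?thesis
      unfolding G_def G'_def by (auto intro!: derivative_eq_intros i)
  qed
  have contH: "continuous_on ?U (\<lambda>z. H' z u)" for u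
    unfolding H'_def
    by (intro continuous_intros continuous_on_compose2[OF cont\<Theta>'] continuous_on_compose2[OF contF]) auto
  have contG: "continuous_on ?V (\<lambda>y. G' y u)" for u
    unfolding G'_def
    by (intro continuous_intros continuous_on_compose2[OF cont_inv] continuous_on_compose2[OF contF]
        continuous_on_compose2[OF cont\<Theta>i]) (auto simp: maps)
  have eqH: "z \<in> epi \<phi> \<longleftrightarrow> H z \<in> epi_cone B" if "z \<in> ?U" for z
    using that epi_iff by (cases z) (auto simp: H_def)
  have eqG: "y \<in> epi_cone B \<longleftrightarrow> G y \<in> epi \<phi>" if "y \<in> ?V" for y
  proof -
    have "G y \<in> ?U" using that by (cases y) (simp add: G_def maps)
    moreover have "H (G y) = y" using that homH by (auto simp: homeomorphism_def)
    ultimately show ?thesis using eqH[of "G y"] by simp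
  qed
  have Hx: "H (x, r) = (\<Theta> x, r - f x)" "G (\<Theta> x, r - f x) = (x, r)"
    using x by (simp_all add: H_def G_def maps)
  have adjH: "adjoint (H' (x, r)) (\<mu>, -1) = (F x + adjoint (\<Theta>' x) \<mu>, -1)"
  proof (rule adjoint_eqI)
    show "linear (H' (x, r))" using derH[of "(x, r)"] x has_derivative_linear by auto
    show "H' (x, r) u \<bullet> (\<mu>, -1) = u \<bullet> (F x + adjoint (\<Theta>' x) \<mu>, -1)" for u
      using linear\<Theta>'[OF x] by (cases u) (simp add: H'_def adjoint_works inner_add_right inner_commute)
  qed
  have adjG: "adjoint (G' (\<Theta> x, r - f x)) (F x + adjoint (\<Theta>' x) \<mu>, -1) = (\<mu>, -1)"
  proof (rule adjoint_eqI)
    show "linear (G' (\<Theta> x, r - f x))"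
      using derG[of "(\<Theta> x, r - f x)"] x maps has_derivative_linear by auto
    show "G' (\<Theta> x, r - f x) u \<bullet> (F x + adjoint (\<Theta>' x) \<mu>, -1) = u \<bullet> (\<mu>, -1)" for u
      using linear\<Theta>'[OF x] x
      by (cases u) (simp add: G'_def adjoint_works inner_add_right maps inv_\<Theta>' inner_commute[of "F x"])
  qed
  show ?thesis
  proof
    assume "(\<mu>, -1) \<in> limiting_normal_cone (epi_cone B) (\<Theta> x, r - f x)"
    then show "(F x + adjoint (\<Theta>' x) \<mu>, -1) \<in> limiting_normal_cone (epi \<phi>) (x, r)"
      using limiting_normal_cone_pullback[OF homH opUV _ derH contH eqH, of "(x, r)" "(\<mu>, -1)"] x
      by (simp add: Hx adjH)
  next
    assume "(F x + adjoint (\<Theta>' x) \<mu>, -1) \<in> limiting_normal_cone (epi \<phi>) (x, r)"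
    then show "(\<mu>, -1) \<in> limiting_normal_cone (epi_cone B) (\<Theta> x, r - f x)"
      using limiting_normal_cone_pullback[OF homeomorphism_symD[OF homH] opUV(2,1) _ derG contG eqG,
          of "(\<Theta> x, r - f x)" "(F x + adjoint (\<Theta>' x) \<mu>, -1)"] x maps
      by (simp add: Hx adjG)
  qed
qed

lemma subdifferential_iff:
  assumes x: "x \<in> W"
  shows "F x + adjoint (\<Theta>' x) \<mu> \<in> subdifferential \<phi> x \<longleftrightarrow> (\<Theta> x, \<mu>) \<in> inverse_normal_graph D"
proof
  assume "F x + adjoint (\<Theta>' x) \<mu> \<in> subdifferential \<phi> x"
  then obtain r where r: "\<phi> x = ereal r"
    and "(F x + adjoint (\<Theta>' x) \<mu>, -1) \<in> limiting_normal_cone (epi \<phi>) (x, r)"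
    by (auto simp: subdifferential_def)
  then have "(\<mu>, -1) \<in> limiting_normal_cone (epi_cone B) (\<Theta> x, r - f x)"
    using limiting_normal_cone_epi[OF x] by simp
  moreover have "(\<Theta> x, r - f x) \<in> epi_cone B"
    using r epi_iff[OF x, of r] by (simp add: mem_epi)
  ultimately show "(\<Theta> x, \<mu>) \<in> inverse_normal_graph D"
    using limiting_normal_cone_epi_cone[of B "\<Theta> x" "r - f x" \<mu>] nonneg unfolding D_def by simp
next
  assume \<mu>: "(\<Theta> x, \<mu>) \<in> inverse_normal_graph D"
  \<comment> \<open>At a graph point \<open>\<mu>\<close> attains the support value at
    \<open>\<Theta> x\<close>, so this is the only possible value of
    \<open>\<phi> x\<close>.\<close>
  define r where "r = f x + \<mu> \<bullet> \<Theta> x"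
  have "r - f x = \<mu> \<bullet> \<Theta> x" by (simp add: r_def)
  with \<mu> have N: "(\<Theta> x, r - f x) \<in> epi_cone B"
    "(\<mu>, -1) \<in> limiting_normal_cone (epi_cone B) (\<Theta> x, r - f x)"
    using limiting_normal_cone_epi_cone[of B "\<Theta> x" "r - f x" \<mu>] nonneg
    unfolding D_def by blast+
  have "\<phi> x = ereal r"
  proof (rule ereal_eq_if_epi)
    show "\<phi> x \<le> ereal r" using N(1) epi_iff[OF x] by (simp add: mem_epi)
    fix s assume "\<phi> x \<le> ereal s"
    then have "(\<Theta> x, s - f x) \<in> epi_cone B" using epi_iff[OF x] by (simp add: mem_epi)
    then show "r \<le> s"
      using \<mu> by (force simp: inverse_normal_graph_def D_def dual_section_def r_def)
  qed
  then show "F x + adjoint (\<Theta>' x) \<mu> \<in> subdifferential \<phi> x"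
    using N(2) limiting_normal_cone_epi[OF x] by (simp add: subdifferential_def)
qed

text \<open>The unique \<open>\<mu>\<close> with
  \<open>F x + adjoint (\<Theta>' x) \<mu> = v\<close>, for \<open>x\<close> in
  \<open>W\<close>.\<close>

definition multiplier :: "'a \<Rightarrow> 'a \<Rightarrow> 'a" where
  "multiplier x v = adjoint (inv (\<Theta>' x)) (v - F x)"

lemma multiplier_inverse:
  assumes "x \<in> W"
  shows "F x + adjoint (\<Theta>' x) (multiplier x v) = v" "multiplier x (F x + adjoint (\<Theta>' x) \<mu>) = \<mu>"
  using assms by (simp_all add: multiplier_def adjoint_inv)

lemma subdifferential_iff_multiplier:
  "x \<in> W \<Longrightarrow> v \<in> subdifferential \<phi> x \<longleftrightarrow> (\<Theta> x, multiplier x v) \<in> inverse_normal_graph D"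
  using subdifferential_iff[of x "multiplier x v"] by (simp add: multiplier_inverse)

lemma continuous_on_multiplier: "continuous_on (W \<times> UNIV) (\<lambda>z. multiplier (fst z) (snd z))"
  unfolding multiplier_def
  by (intro continuous_on_adjoint continuous_intros continuous_on_compose2[OF cont_inv]
      continuous_on_compose2[OF contF]) (auto simp: linear_inv)

text \<open>The two graphs are compared through the intermediate set \<open>M\<close> of pairs
  \<open>(x, \<mu>)\<close>: \<open>H\<close> changes only the point and \<open>\<Psi>\<close> only
  the subgradient, so each has an explicit inverse derivative.\<close>

lemma strictly_proto_differentiable_iff:
  assumes x: "x \<in> W" and v: "v \<in> subdifferential \<phi> x"
  shows "strictly_proto_differentiable (subdifferential \<phi>) x v \<longleftrightarrow>
    paratingent_cone (inverse_normal_graph D) (\<Theta> x, multiplier x v) =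
    regular_tangent_cone (inverse_normal_graph D) (\<Theta> x, multiplier x v)"
proof -
  let ?U = "W \<times> (UNIV :: 'a set)" and ?V = "V \<times> (UNIV :: 'a set)"
  have opUV: "open ?U" "open ?V" using op by (auto intro: open_Times)
  define M where "M = {z. fst z \<in> W \<and> (\<Theta> (fst z), snd z) \<in> inverse_normal_graph D}"
  define \<mu> where "\<mu> = multiplier x v"
  have z: "(x, \<mu>) \<in> ?U" "(x, \<mu>) \<in> M"
    using x v subdifferential_iff_multiplier by (auto simp: M_def \<mu>_def)

  define H :: "'a \<times> 'a \<Rightarrow> 'a \<times> 'a" where "H z = (\<Theta> (fst z), snd z)" for z
  define H' :: "'a \<times> 'a \<Rightarrow> 'a \<times> 'a \<Rightarrow> 'a \<times> 'a" where "H' z = (\<lambda>u. (\<Theta>' (fst z) (fst u), snd u))" for z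
  define H'i :: "'a \<times> 'a \<Rightarrow> 'a \<times> 'a" where "H'i = (\<lambda>u. (inv (\<Theta>' x) (fst u), snd u))"
  have homH: "homeomorphism ?U ?V H (\<lambda>y. (\<Theta>i (fst y), snd y))"
    by (rule homeomorphismI; (unfold H_def)?;
        (intro continuous_intros continuous_on_compose2[OF cont\<Theta>] continuous_on_compose2[OF cont\<Theta>i])?)
      (auto simp: H_def maps)
  have "has_strict_derivative H (H' (x, \<mu>)) (x, \<mu>)"
  proof (rule has_strict_derivative_C1[OF opUV(1) z(1)])
    show "(H has_derivative H' z) (at z)" if "z \<in> ?U" for z
    proof -
      have "fst z \<in> W" using that by auto
      from has_derivative_compose_fst[OF der\<Theta>[OF this]] show ?thesis
        unfolding H_def H'_def
        by (intro has_derivative_Pair has_derivative_snd has_derivative_ident)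
    qed
    show "continuous_on ?U (\<lambda>z. H' z u)" for u
      unfolding H'_def by (intro continuous_intros continuous_on_compose2[OF cont\<Theta>']) auto
  qed
  moreover have "bounded_linear H'i"
    unfolding H'i_def using linear_inv[OF x]
    by (intro bounded_linear_Pair bounded_linear_compose[OF _ bounded_linear_fst] bounded_linear_snd)
      (simp add: linear_conv_bounded_linear)
  ultimately have 1: "paratingent_cone M (x, \<mu>) = regular_tangent_cone M (x, \<mu>) \<longleftrightarrow>
      paratingent_cone (inverse_normal_graph D) (H (x, \<mu>)) = regular_tangent_cone (inverse_normal_graph D) (H (x, \<mu>))"
    by (rule tangent_cones_eq_homeomorphism[where f'i = H'i, OF _ _ _ _ homH opUV z])
      (use x in \<open>auto simp: H'i_def H'_def H_def M_def inv_\<Theta>'\<close>)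

  define \<Psi> :: "'a \<times> 'a \<Rightarrow> 'a \<times> 'a" where "\<Psi> z = (fst z, F (fst z) + adjoint (\<Theta>' (fst z)) (snd z))" for z
  define \<Psi>' :: "'a \<times> 'a \<Rightarrow> 'a \<times> 'a \<Rightarrow> 'a \<times> 'a" where "\<Psi>' z = (\<lambda>u. (fst u, P z u))" for z
  \<comment> \<open>The derivative of \<open>\<Psi>\<close> is block triangular: remove the effect
    of the first component, then invert the adjoint.\<close>
  define \<Psi>'i :: "'a \<times> 'a \<Rightarrow> 'a \<times> 'a"
    where "\<Psi>'i = (\<lambda>u. (fst u, adjoint (inv (\<Theta>' x)) (snd u - P (x, \<mu>) (fst u, 0))))"
  have hom\<Psi>: "homeomorphism ?U ?U \<Psi> (\<lambda>y. (fst y, multiplier (fst y) (snd y)))"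
  proof (rule homeomorphismI)
    show "continuous_on ?U \<Psi>"
      unfolding \<Psi>_def
      by (intro continuous_intros continuous_on_adjoint continuous_on_compose2[OF cont\<Theta>']
          continuous_on_compose2[OF contF]) (auto simp: linear\<Theta>')
  qed (auto simp: \<Psi>_def multiplier_inverse intro!: continuous_intros continuous_on_multiplier)
  interpret P: bounded_linear "P (x, \<mu>)"
    using derP[OF x] by (rule has_derivative_bounded_linear)
  have P: "P (x, \<mu>) u = P (x, \<mu>) (fst u, 0) + adjoint (\<Theta>' x) (snd u)" for u
    using P.add[of "(fst u, 0)" "(0, snd u)"] P_snd[OF x] by simp
  have "has_strict_derivative \<Psi> (\<Psi>' (x, \<mu>)) (x, \<mu>)"
  proof (rule has_strict_derivative_C1[OF opUV(1) z(1)])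
    show "(\<Psi> has_derivative \<Psi>' z) (at z)" if "z \<in> ?U" for z
      unfolding \<Psi>_def \<Psi>'_def using that derP[of "fst z" "snd z"]
      by (intro has_derivative_Pair has_derivative_fst has_derivative_ident) auto
    show "continuous_on ?U (\<lambda>z. \<Psi>' z u)" for u
      unfolding \<Psi>'_def by (intro continuous_intros contP)
  qed
  moreover have "bounded_linear \<Psi>'i"
  proof -
    have "bounded_linear (adjoint (inv (\<Theta>' x)))"
      using linear_inv[OF x] by (simp add: adjoint_linear flip: linear_conv_bounded_linear)
    moreover have "bounded_linear (\<lambda>u :: 'a \<times> 'a. P (x, \<mu>) (fst u, 0))"
      by (intro bounded_linear_compose[OF P.bounded_linear_axioms] bounded_linear_Pair
          bounded_linear_fst bounded_linear_zero)
    ultimately show ?thesis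
      unfolding \<Psi>'i_def
      by (intro bounded_linear_Pair bounded_linear_fst)
        (rule bounded_linear_compose, assumption, rule bounded_linear_sub[OF bounded_linear_snd])
  qed
  moreover have "\<Psi>'i (\<Psi>' (x, \<mu>) u) = u" for u
    using x by (simp add: \<Psi>'i_def \<Psi>'_def P[of u] adjoint_inv)
  moreover have "\<Psi>' (x, \<mu>) (\<Psi>'i u) = u" for u
    using x P[of "\<Psi>'i u"] by (simp add: \<Psi>'i_def \<Psi>'_def adjoint_inv)
  moreover have "y \<in> M \<longleftrightarrow> \<Psi> y \<in> gph (subdifferential \<phi>)" if "y \<in> ?U" for y
    using that subdifferential_iff[of "fst y" "snd y"] by (auto simp: M_def \<Psi>_def gph_def)
  ultimately have 2: "paratingent_cone M (x, \<mu>) = regular_tangent_cone M (x, \<mu>) \<longleftrightarrow>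
      paratingent_cone (gph (subdifferential \<phi>)) (\<Psi> (x, \<mu>)) = regular_tangent_cone (gph (subdifferential \<phi>)) (\<Psi> (x, \<mu>))"
    by (intro tangent_cones_eq_homeomorphism[OF _ _ _ _ hom\<Psi> opUV(1,1) z])
  show ?thesis
    unfolding strictly_proto_differentiable_def
    using v 1 2 x by (simp add: \<Psi>_def H_def \<mu>_def multiplier_inverse)
qed

text \<open>The normalization of \<open>\<Theta>\<close> at \<open>x\<close> gives
  \<open>F x\<close> the multiplier 0 and turns the subdifferential into \<open>F x + D\<close>, so
  everything happens at the origin of \<open>D\<close>. The forward direction evaluates the property
  at \<open>(x, F x)\<close> itself.\<close>

theorem strictly_proto_differentiable_around_iff:
  assumes x: "x \<in> W" "\<Theta> x = 0" "\<And>u. \<Theta>' x u = u" and D: "0 \<in> D"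
  shows "(\<exists>U. open U \<and> (x, F x) \<in> U \<and>
            (\<forall>(y, v) \<in> U \<inter> gph (subdifferential \<phi>).
               strictly_proto_differentiable (subdifferential \<phi>) y v))
         \<longleftrightarrow> F x \<in> rel_interior (subdifferential \<phi> x)"
proof -
  have adj: "adjoint (\<Theta>' x) \<mu> = \<mu>" for \<mu>
    by (rule adjoint_eqI) (use x linear\<Theta>' in auto)
  have mult: "multiplier x (F x) = 0"
    using multiplier_inverse(2)[OF x(1), of 0] by (simp add: adj)
  have sub: "subdifferential \<phi> x = (+) (F x) ` D"
  proof (intro set_eqI)
    fix v
    have "v \<in> subdifferential \<phi> x \<longleftrightarrow> v - F x \<in> D"
      using subdifferential_iff[OF x(1), of "v - F x"] by (simp add: adj x inverse_normal_graph_def)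
    also have "\<dots> \<longleftrightarrow> v \<in> (+) (F x) ` D"
      by (auto intro!: image_eqI[of _ _ "v - F x"])
    finally show "v \<in> subdifferential \<phi> x \<longleftrightarrow> v \<in> (+) (F x) ` D" .
  qed
  have mem: "F x \<in> subdifferential \<phi> x"
    using sub D by (auto intro!: image_eqI[of _ _ 0])
  have ri: "F x \<in> rel_interior (subdifferential \<phi> x) \<longleftrightarrow> 0 \<in> rel_interior D"
    unfolding sub by (auto simp: rel_interior_translation)
  show ?thesis
    unfolding ri
  proof
    assume "\<exists>U. open U \<and> (x, F x) \<in> U \<and> (\<forall>(y, v) \<in> U \<inter> gph (subdifferential \<phi>).
               strictly_proto_differentiable (subdifferential \<phi>) y v)"
    then have "strictly_proto_differentiable (subdifferential \<phi>) x (F x)"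
      using mem by (auto simp: gph_def)
    then show "0 \<in> rel_interior D"
      using strictly_proto_differentiable_iff[OF x(1) mem] D x(2) mult convex_dual_section
      by (intro zero_in_rel_interior_if_tangent_cones_eq) (auto simp: D_def)
  next
    assume "0 \<in> rel_interior D"
    then obtain e where e: "e > 0" "\<And>y \<mu>. (y, \<mu>) \<in> inverse_normal_graph D \<Longrightarrow> norm \<mu> < e \<Longrightarrow>
        paratingent_cone (inverse_normal_graph D) (y, \<mu>) = regular_tangent_cone (inverse_normal_graph D) (y, \<mu>)"
      using inverse_normal_graph_tangent_cones_eq by blast
    \<comment> \<open>The radius \<open>e\<close> constrains only the multiplier, which depends
      continuously on the point and the subgradient.\<close>
    define U where "U = (W \<times> UNIV) \<inter> (\<lambda>z. multiplier (fst z) (snd z)) -` ball 0 e"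
    have "open U"
      unfolding U_def using op by (intro continuous_open_preimage continuous_on_multiplier open_Times) auto
    moreover have "(x, F x) \<in> U" using x e mult by (simp add: U_def)
    moreover have "strictly_proto_differentiable (subdifferential \<phi>) y v"
      if "(y, v) \<in> U" "v \<in> subdifferential \<phi> y" for y v
    proof -
      have y: "y \<in> W" "norm (multiplier y v) < e" using that by (auto simp: U_def)
      with that(2) have "(\<Theta> y, multiplier y v) \<in> inverse_normal_graph D"
        using subdifferential_iff_multiplier by blast
      from e(2)[OF this y(2)] show ?thesis
        using strictly_proto_differentiable_iff[OF y(1) that(2)] by blast
    qed
    ultimately show "\<exists>U. open U \<and> (x, F x) \<in> U \<and> (\<forall>(y, v) \<in> U \<inter> gph (subdifferential \<phi>).
               strictly_proto_differentiable (subdifferential \<phi>) y v)"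
      by (auto simp: gph_def)
  qed
qed

end


section \<open>Polyhedral functions\<close>

lemma subdifferential_convex:
  assumes "convex (epi g)"
  shows "\<mu> \<in> subdifferential g z \<longleftrightarrow>
    (\<exists>r. g z = ereal r \<and> (\<forall>(z', r')\<in>epi g. \<mu> \<bullet> (z' - z) \<le> r' - r))"
proof -
  have "(\<mu>, -1) \<in> limiting_normal_cone (epi g) (z, r) \<longleftrightarrow> (\<forall>(z', r')\<in>epi g. \<mu> \<bullet> (z' - z) \<le> r' - r)"
    if "g z = ereal r" for r
    using limiting_normal_cone_convex[OF assms, of "(z, r)"] that by (auto simp: mem_epi)
  then show ?thesis by (auto simp: subdifferential_def)
qed

lemma subdifferential_monotone:
  assumes "convex (epi g)" "\<mu> \<in> subdifferential g z" "\<mu>' \<in> subdifferential g z'"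
  shows "0 \<le> (\<mu> - \<mu>') \<bullet> (z - z')"
proof -
  obtain r r' where "g z = ereal r" "g z' = ereal r'"
    and *: "\<forall>(x, s)\<in>epi g. \<mu> \<bullet> (x - z) \<le> s - r" "\<forall>(x, s)\<in>epi g. \<mu>' \<bullet> (x - z') \<le> s - r'"
    using assms(2,3) unfolding subdifferential_convex[OF assms(1)] by blast
  then have "(z, r) \<in> epi g" "(z', r') \<in> epi g" by (auto simp: mem_epi)
  with * have "\<mu> \<bullet> (z' - z) \<le> r' - r" "\<mu>' \<bullet> (z - z') \<le> r - r'" by auto
  then show ?thesis by (simp add: inner_diff_left inner_diff_right)
qed

lemma convex_subdifferential:
  assumes "convex (epi g)"
  shows "convex (subdifferential g z)"
proof (rule convexI)
  fix \<mu> \<nu> and u v :: real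
  assume *: "\<mu> \<in> subdifferential g z" "\<nu> \<in> subdifferential g z" "0 \<le> u" "0 \<le> v" "u + v = 1"
  then obtain r where r: "g z = ereal r" "\<And>z' r'. (z', r') \<in> epi g \<Longrightarrow> \<mu> \<bullet> (z' - z) \<le> r' - r"
    "\<And>z' r'. (z', r') \<in> epi g \<Longrightarrow> \<nu> \<bullet> (z' - z) \<le> r' - r"
    unfolding subdifferential_convex[OF assms] by fastforce
  have "(u *\<^sub>R \<mu> + v *\<^sub>R \<nu>) \<bullet> (z' - z) \<le> r' - r" if "(z', r') \<in> epi g" for z' r'
  proof -
    have "u * (\<mu> \<bullet> (z' - z)) + v * (\<nu> \<bullet> (z' - z)) \<le> u * (r' - r) + v * (r' - r)"
      using * r that by (intro add_mono mult_left_mono) auto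
    also have "\<dots> = r' - r" using * by (simp flip: distrib_right)
    finally show ?thesis by (simp add: inner_add_left)
  qed
  then show "u *\<^sub>R \<mu> + v *\<^sub>R \<nu> \<in> subdifferential g z"
    unfolding subdifferential_convex[OF assms] using r(1) by auto
qed

text \<open>For \<open>c\<close> in \<open>C\<close> this is the direction space of
  \<open>affine hull C\<close>.\<close>

definition parallel_subspace :: "'a::real_vector set \<Rightarrow> 'a \<Rightarrow> 'a set" where
  "parallel_subspace C c = span ((+) (- c) ` C)"

lemma mem_parallel_subspace: "c' \<in> C \<Longrightarrow> c' - c \<in> parallel_subspace C c"
  unfolding parallel_subspace_def by (rule span_base) (auto intro: image_eqI[of _ _ c'])

text \<open>
  At relative interior points \<open>\<lambda>\<close> of \<open>\<partial>g(z)\<close> monotonicity forces the first component of every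
  tangent vector to \<open>gph \<partial>g\<close> to be orthogonal to \<open>\<partial>g(z) - \<lambda>\<close>.
\<close>

lemma parallel_subspace_subset_coderivative:
  fixes g :: "'a::euclidean_space \<Rightarrow> ereal"
  assumes cv: "convex (epi g)" and lb: "lb \<in> subdifferential g z"
  shows "parallel_subspace (subdifferential g z) lb \<subseteq> coderivative (subdifferential g) z lb 0"
proof
  let ?C = "subdifferential g z" and ?L = "parallel_subspace (subdifferential g z) lb"
  fix w assume w: "w \<in> ?L"
  obtain c where c: "c \<in> rel_interior ?C"
    using rel_interior_eq_empty[OF convex_subdifferential[OF cv]] lb by blast
  define e where "e k = inverse (real (Suc k))" for k
  \<comment> \<open>\<open>lb\<close> may lie on the relative boundary, so it is approached along a
    segment from a relative interior point; this is where limiting normals enter.\<close>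
  define l where "l k = lb - e k *\<^sub>R (lb - c)" for k
  have l_ri: "l k \<in> rel_interior ?C" for k
    unfolding l_def using lb c
    by (intro rel_interior_convex_shrink convex_subdifferential cv) (auto simp: e_def inverse_le_1_iff)
  then have l_mem: "l k \<in> ?C" for k
    using rel_interior_subset by blast
  have "l \<longlonglongrightarrow> lb - 0 *\<^sub>R (lb - c)"
    unfolding l_def e_def by (intro tendsto_intros LIMSEQ_inverse_real_of_nat)
  then have lim: "(\<lambda>k. (z, l k)) \<longlonglongrightarrow> (z, lb)"
    by (intro tendsto_Pair tendsto_const) simp
  have "(w, 0) \<in> regular_normal_cone (gph (subdifferential g)) (z, l k)" for k
    unfolding regular_normal_cone_def polar_cone_def
  proof (intro CollectI ballI)
    fix \<zeta> assume "\<zeta> \<in> tangent_cone (gph (subdifferential g)) (z, l k)"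
    then obtain t q where t: "t \<longlonglongrightarrow> 0" "\<forall>\<^sub>F j in sequentially. 0 < t j" and q: "q \<longlonglongrightarrow> \<zeta>"
      and mem: "\<forall>\<^sub>F j in sequentially. (z, l k) + t j *\<^sub>R q j \<in> gph (subdifferential g)"
      unfolding tangent_cone_iff by blast
    obtain d where d: "d > 0" and ball: "ball (l k) d \<inter> affine hull ?C \<subseteq> ?C"
      using l_ri[of k] by (auto simp: mem_rel_interior_ball)
    obtain s where s: "s > 0" "s * norm w < d"
    proof
      have pos: "norm w + 1 > 0" by (simp add: add_nonneg_pos)
      then show "d / (norm w + 1) > 0" using d by simp
      have "d * norm w < d * (norm w + 1)" using d by simp
      then show "d / (norm w + 1) * norm w < d" using pos by (simp add: divide_less_eq)
    qed
    have "l k - lb + s *\<^sub>R w \<in> ?L"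
      using mem_parallel_subspace[OF l_mem] w
      unfolding parallel_subspace_def by (blast intro: span_add span_scale)
    moreover have "affine hull ?C = (+) lb ` ?L"
      unfolding parallel_subspace_def by (rule affine_hull_span_gen[OF hull_inc[OF lb]])
    ultimately have "lb + (l k - lb + s *\<^sub>R w) \<in> affine hull ?C"
      by (simp only: image_eqI[OF refl])
    moreover have "lb + (l k - lb + s *\<^sub>R w) = l k + s *\<^sub>R w" by simp
    ultimately have m: "l k + s *\<^sub>R w \<in> ?C"
      using ball s by (auto simp: dist_norm)
    \<comment> \<open>Monotonicity is tested against the fixed subgradient
      \<open>l k + s *\<^sub>R w\<close> at \<open>z\<close>; after division by \<open>t j\<close>
      only the term with \<open>w\<close> survives the limit.\<close>
    have ev: "\<forall>\<^sub>F j in sequentially. 0 \<le> (t j *\<^sub>R snd (q j) - s *\<^sub>R w) \<bullet> fst (q j)"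
      using t(2) mem
    proof eventually_elim
      case (elim j)
      then have "l k + t j *\<^sub>R snd (q j) \<in> subdifferential g (z + t j *\<^sub>R fst (q j))"
        by (cases "q j") (simp add: gph_def)
      from subdifferential_monotone[OF cv this m]
      have "0 \<le> t j * ((t j *\<^sub>R snd (q j) - s *\<^sub>R w) \<bullet> fst (q j))"
        by (simp add: algebra_simps)
      then show ?case using elim(1) by (simp only: zero_le_mult_iff) auto
    qed
    have "(\<lambda>j. (t j *\<^sub>R snd (q j) - s *\<^sub>R w) \<bullet> fst (q j)) \<longlonglongrightarrow> (0 *\<^sub>R snd \<zeta> - s *\<^sub>R w) \<bullet> fst \<zeta>"
      by (intro tendsto_intros t q)
    from tendsto_lowerbound[OF this ev] have "w \<bullet> fst \<zeta> \<le> 0"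
      using s by (simp add: mult_le_0_iff)
    then show "(w, 0) \<bullet> \<zeta> \<le> 0" by (cases \<zeta>) simp
  qed
  then have "(w, 0) \<in> limiting_normal_cone (gph (subdifferential g)) (z, lb)"
    unfolding limiting_normal_cone_iff using lim l_mem
    by (intro exI[of _ "\<lambda>k. (z, l k)"] exI[of _ "\<lambda>_. (w, 0)"]) (simp add: gph_def)
  then show "w \<in> coderivative (subdifferential g) z lb 0"
    by (simp add: coderivative_def)
qed

section \<open>Local form of a polyhedral function\<close>

lemma polyhedron_finite_halfspaces:
  fixes S :: "'a::euclidean_space set"
  assumes "polyhedron S"
  obtains A where "finite A" "S = {x. \<forall>(a, b)\<in>A. a \<bullet> x \<le> b}"
proof -
  obtain F where F: "finite F" "S = \<Inter>F" "\<forall>h\<in>F. \<exists>a b. a \<noteq> 0 \<and> h = {x. a \<bullet> x \<le> b}"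
    using assms unfolding polyhedron_def by blast
  then obtain \<alpha> \<beta> where ab: "\<And>h. h \<in> F \<Longrightarrow> h = {x. \<alpha> h \<bullet> x \<le> \<beta> h}"
    by metis
  have "S = {x. \<forall>(a, b)\<in>(\<lambda>h. (\<alpha> h, \<beta> h)) ` F. a \<bullet> x \<le> b}"
    unfolding F(2) using ab by blast
  with F(1) that show ?thesis by blast
qed

text \<open>
  Every constraint active at \<open>(z, g z)\<close> has its normal in the cone generated by \<open>\<partial>g(z) \<times> {-1}\<close>,
  so after tilting by \<open>lb\<close> only directions parallel to \<open>\<partial>g(z)\<close> occur. One active constraint is not
  vertical; it makes the description valid for all heights \<open>s\<close>, not only for those near \<open>g z\<close>.
\<close>

lemma polyhedral_fun_local:
  fixes g :: "'a::euclidean_space \<Rightarrow> ereal"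
  assumes poly: "polyhedron (epi g)" and gz: "g z = ereal r" and lb: "lb \<in> subdifferential g z"
  shows "\<exists>N B. open N \<and> z \<in> N \<and>
    (\<forall>(l, \<sigma>)\<in>B. 0 \<le> \<sigma> \<and> l \<in> parallel_subspace (subdifferential g z) lb) \<and>
    (\<forall>z'\<in>N. \<forall>s. (z', s) \<in> epi g \<longleftrightarrow> (z' - z, s - (r + lb \<bullet> (z' - z))) \<in> epi_cone B)"
proof -
  obtain A where "finite A" and A': "epi g = {x. \<forall>(a, b)\<in>A. a \<bullet> x \<le> b}"
    using polyhedron_finite_halfspaces[OF poly] .
  have A: "(z', s) \<in> epi g \<longleftrightarrow> (\<forall>(a, b)\<in>A. fst a \<bullet> z' + snd a * s \<le> b)" for z' s
    unfolding A' by (auto simp: inner_prod_def)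
  define act where "act = {(a, b)\<in>A. fst a \<bullet> z + snd a * r = b}"
  have act: "act \<subseteq> A" "finite (A - act)" using \<open>finite A\<close> by (auto simp: act_def)
  have le: "fst a \<bullet> z + snd a * r \<le> b" if "(a, b) \<in> A" for a b
    using A[of z r] gz that by (auto simp: mem_epi)
  then have less: "fst a \<bullet> z + snd a * r < b" if "(a, b) \<in> A - act" for a b
    using that by (fastforce simp: act_def)
  \<comment> \<open>Epigraphs are unbounded upwards, so a positive coefficient of the height would
    be violated far above \<open>z\<close>.\<close>
  have slope: "snd a \<le> 0" if "(a, b) \<in> A" for a b
  proof (rule ccontr)
    assume pos: "\<not> snd a \<le> 0"
    define s where "s = max r ((b - fst a \<bullet> z) / snd a + 1)"
    have "(z, s) \<in> epi g" using gz by (simp add: mem_epi s_def)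
    then have "fst a \<bullet> z + snd a * s \<le> b" using A that by blast
    then have "s \<le> (b - fst a \<bullet> z) / snd a" using pos by (simp add: field_simps)
    then show False by (simp add: s_def)
  qed
  \<comment> \<open>Slightly below the graph the inactive constraints still hold strictly, so
    leaving the epigraph there must violate an active one, which is therefore not vertical.\<close>
  have "\<forall>\<^sub>F s in at_left r. \<forall>p\<in>A - act. fst (fst p) \<bullet> z + snd (fst p) * s < snd p"
  proof (rule eventually_ball_finite[OF act(2)], rule ballI)
    fix p assume p: "p \<in> A - act"
    have "((\<lambda>s. fst (fst p) \<bullet> z + snd (fst p) * s) \<longlongrightarrow> fst (fst p) \<bullet> z + snd (fst p) * r) (at_left r)"
      by (intro tendsto_intros)
    then show "\<forall>\<^sub>F s in at_left r. fst (fst p) \<bullet> z + snd (fst p) * s < snd p"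
      using less[of "fst p" "snd p"] p by (intro order_tendstoD) auto
  qed
  moreover have "\<forall>\<^sub>F s in at_left r. s < r" by (simp add: eventually_at_filter)
  ultimately have "\<forall>\<^sub>F s in at_left r. s < r \<and> (\<forall>p\<in>A - act. fst (fst p) \<bullet> z + snd (fst p) * s < snd p)"
    by eventually_elim simp
  from eventually_happens[OF this] obtain s0
    where s0: "s0 < r" and s0_all: "\<forall>p\<in>A - act. fst (fst p) \<bullet> z + snd (fst p) * s0 < snd p"
    by (auto simp: trivial_limit_at_left_real)
  have s0_less: "fst a \<bullet> z + snd a * s0 < b" if "(a, b) \<in> A - act" for a b
    using bspec[OF s0_all that] by simp
  have "(z, s0) \<notin> epi g" using s0 gz by (simp add: mem_epi)
  then obtain a0 b0 where "(a0, b0) \<in> A" "\<not> fst a0 \<bullet> z + snd a0 * s0 \<le> b0"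
    using A by blast
  with s0_less[of a0 b0] have a0: "(a0, b0) \<in> act" "fst a0 \<bullet> z + snd a0 * s0 > b0"
    by (auto simp: not_le)
  \<comment> \<open>Over \<open>N\<close> the constraint \<open>a0\<close> still fails at height
    \<open>s0\<close>, so the active constraints force \<open>s0 \<le> s\<close>; the inactive ones
    hold at \<open>s0\<close> and, their slopes being nonpositive, at every such
    \<open>s\<close>.\<close>
  define N where "N = (\<Inter>(a, b)\<in>A - act. {z'. fst a \<bullet> z' + snd a * s0 < b}) \<inter> {z'. fst a0 \<bullet> z' + snd a0 * s0 > b0}"
  have "open N"
    unfolding N_def using act(2)
    by (auto intro!: open_Int open_INT open_Collect_less continuous_intros)
  have "z \<in> N" using s0_less a0(2) by (auto simp: N_def)
  have loc: "(z', s) \<in> epi g \<longleftrightarrow> (\<forall>(a, b)\<in>act. fst a \<bullet> z' + snd a * s \<le> b)" if z': "z' \<in> N" for z' s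
  proof
    assume "(z', s) \<in> epi g"
    then show "\<forall>(a, b)\<in>act. fst a \<bullet> z' + snd a * s \<le> b" using A act(1) by blast
  next
    assume *: "\<forall>(a, b)\<in>act. fst a \<bullet> z' + snd a * s \<le> b"
    have s: "s0 \<le> s"
    proof (rule ccontr)
      assume "\<not> s0 \<le> s"
      then have "snd a0 * s0 \<le> snd a0 * s"
        using slope[of a0 b0] a0(1) act(1) by (intro mult_left_mono_neg) auto
      moreover have "fst a0 \<bullet> z' + snd a0 * s \<le> b0" using * a0(1) by blast
      ultimately show False using z' by (auto simp: N_def)
    qed
    have "fst a \<bullet> z' + snd a * s \<le> b" if "(a, b) \<in> A - act" for a b
    proof -
      have "snd a * s \<le> snd a * s0" using slope[of a b] that s by (intro mult_left_mono_neg) auto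
      moreover have "fst a \<bullet> z' + snd a * s0 < b" using z' that by (auto simp: N_def)
      ultimately show ?thesis by linarith
    qed
    with * show "(z', s) \<in> epi g" unfolding A by blast
  qed
  \<comment> \<open>The active constraints rewritten for displacements from \<open>z\<close> and
    heights above the affine minorant with slope \<open>lb\<close>.\<close>
  define B where "B = (\<lambda>(a, b). (fst a + snd a *\<^sub>R lb, - snd a)) ` act"
  have cv: "convex (epi g)" using poly by (rule polyhedron_imp_convex)
  have par: "fst a + snd a *\<^sub>R lb \<in> parallel_subspace (subdifferential g z) lb" if ab: "(a, b) \<in> act" for a b
  proof -
    let ?C = "subdifferential g z"
    have b: "b = fst a \<bullet> z + snd a * r" and abA: "(a, b) \<in> A" using ab by (auto simp: act_def)
    have ineq: "fst a \<bullet> (z' - z) \<le> - snd a * (s - r)" if "(z', s) \<in> epi g" for z' s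
    proof -
      have "fst a \<bullet> z' + snd a * s \<le> b" using that A abA by blast
      then show ?thesis by (simp add: b inner_diff_right algebra_simps)
    qed
    have lb': "lb \<bullet> (z' - z) \<le> s - r" if "(z', s) \<in> epi g" for z' s
      using lb that gz unfolding subdifferential_convex[OF cv] by auto
    show ?thesis
    \<comment> \<open>A vertical normal can be added to the subgradient \<open>lb\<close>; a
      non-vertical one, scaled to last component \<open>-1\<close>, is itself a subgradient.\<close>
    proof (cases "snd a = 0")
      case True
      have "lb + fst a \<in> ?C"
        unfolding subdifferential_convex[OF cv] using gz ineq lb' True
        by (fastforce simp: inner_add_left)
      from mem_parallel_subspace[OF this, of lb] True show ?thesis by simp
    next
      case False
      with slope[OF abA] have neg: "snd a < 0" by simp
      have "(- 1 / snd a) *\<^sub>R fst a \<in> ?C"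
        unfolding subdifferential_convex[OF cv] using gz ineq neg
        by (auto simp: divide_simps) (auto simp: algebra_simps)
      from mem_parallel_subspace[OF this, of lb]
      have "(- snd a) *\<^sub>R ((- 1 / snd a) *\<^sub>R fst a - lb) \<in> parallel_subspace ?C lb"
        unfolding parallel_subspace_def by (rule span_scale)
      then show ?thesis using neg by (simp add: scaleR_diff_right)
    qed
  qed
  show ?thesis
  proof (intro exI conjI ballI allI)
    show "open N" "z \<in> N" by fact+
    show "case p of (l, \<sigma>) \<Rightarrow> 0 \<le> \<sigma> \<and> l \<in> parallel_subspace (subdifferential g z) lb" if "p \<in> B" for p
      using that par slope act(1) by (fastforce simp: B_def)
    fix z' s assume z': "z' \<in> N"
    have "fst a \<bullet> z' + snd a * s \<le> b \<longleftrightarrow>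
        (fst a + snd a *\<^sub>R lb) \<bullet> (z' - z) \<le> - snd a * (s - (r + lb \<bullet> (z' - z)))" if "(a, b) \<in> act" for a b
    proof -
      have b: "b = fst a \<bullet> z + snd a * r" using that by (auto simp: act_def)
      have "- snd a * (s - (r + lb \<bullet> (z' - z))) - (fst a + snd a *\<^sub>R lb) \<bullet> (z' - z) = b - (fst a \<bullet> z' + snd a * s)"
        unfolding b by (simp add: inner_add_left inner_diff_right algebra_simps)
      then show ?thesis by linarith
    qed
    then show "(z', s) \<in> epi g \<longleftrightarrow> (z' - z, s - (r + lb \<bullet> (z' - z))) \<in> epi_cone B"
      unfolding loc[OF z'] by (auto simp: epi_cone_def B_def)
  qed
qed

text \<open>Scaling \<open>(w, s)\<close> down into \<open>N\<close> reduces this to the subgradient inequality for \<open>lb\<close>.\<close>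

lemma epi_cone_height_nonneg:
  fixes g :: "'a::euclidean_space \<Rightarrow> ereal"
  assumes cv: "convex (epi g)" and gz: "g z = ereal r" and lb: "lb \<in> subdifferential g z"
    and N: "open N" "z \<in> N"
    and loc: "\<And>z' s. z' \<in> N \<Longrightarrow> (z', s) \<in> epi g \<longleftrightarrow> (z' - z, s - (r + lb \<bullet> (z' - z))) \<in> epi_cone B"
    and ws: "(w, s) \<in> epi_cone B"
  shows "0 \<le> s"
proof -
  have "((\<lambda>t. z + t *\<^sub>R w) \<longlongrightarrow> z + 0 *\<^sub>R w) (at_right 0)"
    by (intro tendsto_intros)
  then have "\<forall>\<^sub>F t in at_right 0. z + t *\<^sub>R w \<in> N"
    using N by (intro topological_tendstoD) auto
  moreover have "\<forall>\<^sub>F t in at_right 0. t > (0::real)" by (simp add: eventually_at_filter)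
  ultimately have "\<forall>\<^sub>F t in at_right 0. t > (0::real) \<and> z + t *\<^sub>R w \<in> N"
    by eventually_elim simp
  from eventually_happens[OF this] obtain t where t: "t > 0" "z + t *\<^sub>R w \<in> N"
    by auto
  have "(t *\<^sub>R w, t * s) \<in> epi_cone B" using ws t by (intro epi_cone_scale) auto
  then have "(z + t *\<^sub>R w, t * s + (r + lb \<bullet> (t *\<^sub>R w))) \<in> epi g"
    using loc[OF t(2), of "t * s + (r + lb \<bullet> (t *\<^sub>R w))"] by simp
  then have "lb \<bullet> (t *\<^sub>R w) \<le> t * s + lb \<bullet> (t *\<^sub>R w)"
    using lb gz unfolding subdifferential_convex[OF cv] by fastforce
  then show ?thesis using t by (simp add: zero_le_mult_iff)
qed


section \<open>Composite functions\<close>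

text \<open>Supplies the product rule and continuity for adjoints of the varying derivative. The
  norm bound comes from pairing the adjoint's value with itself.\<close>

lemma bounded_bilinear_adjoint_blinfun:
  "bounded_bilinear (\<lambda>(T :: 'a::euclidean_space \<Rightarrow>\<^sub>L 'b::euclidean_space) v. adjoint (blinfun_apply T) v)"
proof
  have lin: "linear (blinfun_apply T)" for T :: "'a \<Rightarrow>\<^sub>L 'b"
    by (simp add: bounded_linear.linear blinfun.bounded_linear_right)
  fix S T :: "'a \<Rightarrow>\<^sub>L 'b" and u v :: 'b and c :: real
  show "adjoint (blinfun_apply (S + T)) u = adjoint (blinfun_apply S) u + adjoint (blinfun_apply T) u"
    by (rule adjoint_eqI[OF _ lin])
      (simp add: blinfun.add_left inner_add_left inner_add_right adjoint_works[OF lin])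
  show "adjoint (blinfun_apply (c *\<^sub>R T)) u = c *\<^sub>R adjoint (blinfun_apply T) u"
    by (rule adjoint_eqI[OF _ lin]) (simp add: blinfun.scaleR_left adjoint_works[OF lin])
  show "adjoint (blinfun_apply T) (u + v) = adjoint (blinfun_apply T) u + adjoint (blinfun_apply T) v"
    "adjoint (blinfun_apply T) (c *\<^sub>R u) = c *\<^sub>R adjoint (blinfun_apply T) u"
    using adjoint_linear[OF lin] by (simp_all add: linear_add linear_scale)
  show "\<exists>K. \<forall>(T :: 'a \<Rightarrow>\<^sub>L 'b) u. norm (adjoint (blinfun_apply T) u) \<le> norm T * norm u * K"
  proof (intro exI[of _ 1] allI)
    fix T :: "'a \<Rightarrow>\<^sub>L 'b" and u
    let ?w = "adjoint (blinfun_apply T) u"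
    have "norm ?w * norm ?w = ?w \<bullet> ?w"
      by (simp add: dot_square_norm power2_eq_square)
    also have "\<dots> = blinfun_apply T ?w \<bullet> u"
      by (rule adjoint_works[OF lin])
    also have "\<dots> \<le> norm (blinfun_apply T ?w) * norm u"
      by (rule norm_cauchy_schwarz)
    also have "\<dots> \<le> (norm T * norm ?w) * norm u"
      by (intro mult_right_mono norm_blinfun) simp
    finally have "norm ?w * norm ?w \<le> (norm T * norm u) * norm ?w" by (simp add: mult_ac)
    then show "norm ?w \<le> norm T * norm u * 1"
      by (cases "norm ?w = 0") (auto simp: mult_le_cancel_right)
  qed
qed

text \<open>
  Injectivity of the adjoint on the subspace \<open>L\<close> permits a change of coordinates near \<open>xb\<close> after which
  \<open>\<Phi>\<close> is affine as far as it is seen by \<open>L\<close>: with \<open>G\<close> a left inverse of the adjoint on \<open>L\<close>,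
  \<open>l \<bullet> A (\<Theta> x) = l \<bullet> (\<Phi> x - \<Phi> xb)\<close> for all \<open>l \<in> L\<close>.
\<close>

lemma composite_strictly_proto_differentiable_iff:
  fixes \<phi> :: "'a::euclidean_space \<Rightarrow> ereal" and g :: "'b::euclidean_space \<Rightarrow> ereal"
    and Dp :: "'a \<Rightarrow> 'a \<Rightarrow>\<^sub>L 'b" and D2 :: "'a \<Rightarrow> 'a \<Rightarrow>\<^sub>L ('a \<Rightarrow>\<^sub>L 'b)"
  assumes W0: "open W0" "xb \<in> W0"
    and der: "\<And>x. x \<in> W0 \<Longrightarrow> (\<Phi> has_derivative blinfun_apply (Dp x)) (at x)"
    and der2: "\<And>x. x \<in> W0 \<Longrightarrow> (Dp has_derivative blinfun_apply (D2 x)) (at x)"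
    and cont2: "continuous_on W0 D2"
    and rep: "\<And>x. x \<in> W0 \<Longrightarrow> \<phi> x = g (\<Phi> x)"
    and poly: "polyhedron (epi g)"
    and lb: "lb \<in> subdifferential g (\<Phi> xb)"
    and inj: "\<And>l. l \<in> parallel_subspace (subdifferential g (\<Phi> xb)) lb \<Longrightarrow>
      adjoint (blinfun_apply (Dp xb)) l = 0 \<Longrightarrow> l = 0"
  defines "vb \<equiv> adjoint (blinfun_apply (Dp xb)) lb"
  shows "(\<exists>U. open U \<and> (xb, vb) \<in> U \<and>
            (\<forall>(x, v) \<in> U \<inter> gph (subdifferential \<phi>).
               strictly_proto_differentiable (subdifferential \<phi>) x v))
         \<longleftrightarrow> vb \<in> rel_interior (subdifferential \<phi> xb)"
proof -
  define z where "z = \<Phi> xb"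
  let ?A = "blinfun_apply (Dp xb)"
  let ?L = "parallel_subspace (subdifferential g z) lb"
  have linA: "linear (blinfun_apply T)" for T :: "'a \<Rightarrow>\<^sub>L 'b"
    by (simp add: bounded_linear.linear blinfun.bounded_linear_right)
  have cv: "convex (epi g)" using poly by (rule polyhedron_imp_convex)
  note lb = lb[folded z_def]
  obtain r where gz: "g z = ereal r"
    using lb unfolding subdifferential_convex[OF cv] by blast
  obtain N B where N: "open N" "z \<in> N"
    and B0: "\<forall>(l, \<sigma>)\<in>B. 0 \<le> \<sigma> \<and> l \<in> ?L"
    and loc0: "\<forall>z'\<in>N. \<forall>s. (z', s) \<in> epi g \<longleftrightarrow> (z' - z, s - (r + lb \<bullet> (z' - z))) \<in> epi_cone B"
    using polyhedral_fun_local[OF poly gz lb] by (elim exE conjE)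
  have B: "0 \<le> \<sigma> \<and> l \<in> ?L" if "(l, \<sigma>) \<in> B" for l \<sigma>
    using bspec[OF B0 that] by simp
  have loc: "(z', s) \<in> epi g \<longleftrightarrow> (z' - z, s - (r + lb \<bullet> (z' - z))) \<in> epi_cone B" if "z' \<in> N" for z' s
    using bspec[OF loc0 that] by blast
  have "inj_on (adjoint ?A) ?L"
    unfolding parallel_subspace_def
    using inj[folded z_def] adjoint_linear[OF linA]
    by (subst linear_injective_on_subspace_0) (auto simp: parallel_subspace_def)
  then obtain G where G: "linear G" "\<And>l. l \<in> ?L \<Longrightarrow> G (adjoint ?A l) = l"
    using real_vector.linear_inj_on_left_inverse[OF adjoint_linear[OF linA]]
    unfolding parallel_subspace_def by blast
  \<comment> \<open>By duality \<open>R\<close> is a right inverse of \<open>?A\<close> as seen by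
    \<open>?L\<close>: \<open>adjoint ?A l \<bullet> R w = l \<bullet> w\<close> for
    \<open>l\<close> in \<open>?L\<close>.\<close>
  define R where "R = adjoint G"
  have R: "linear R" "adjoint R = G"
    using G(1) by (simp_all add: R_def adjoint_linear adjoint_adjoint)
  have R': "bounded_linear R" using R(1) by (simp add: linear_conv_bounded_linear)
  have G': "bounded_linear G" using G(1) by (simp add: linear_conv_bounded_linear)

  have cont\<Phi>: "continuous_on W0 \<Phi>" and contDp: "continuous_on W0 Dp"
    by (rule has_derivative_continuous_on[OF has_derivative_at_withinI[OF der]],
        assumption, rule has_derivative_continuous_on[OF has_derivative_at_withinI[OF der2]])
  define W1 where "W1 = W0 \<inter> \<Phi> -` N"
  have W1: "open W1" "xb \<in> W1" "W1 \<subseteq> W0"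
    using continuous_open_preimage[OF cont\<Phi> W0(1) N(1)] W0(2) N(2) by (auto simp: W1_def z_def)
  \<comment> \<open>\<open>R\<close> feeds the nonlinear remainder of \<open>\<Phi>\<close> back
    into the domain; the remainder vanishes to first order at \<open>xb\<close>, which leaves the
    identity as derivative there.\<close>
  define \<Theta> where "\<Theta> x = (x - xb) + R (\<Phi> x - z - ?A (x - xb))" for x
  define T where "T x = id_blinfun + (Blinfun R o\<^sub>L (Dp x - Dp xb))" for x
  define \<Theta>' where "\<Theta>' x = blinfun_apply (T x)" for x
  have \<Theta>'_eq: "\<Theta>' x u = u + R (Dp x u - ?A u)" for x u
    by (simp add: \<Theta>'_def T_def blinfun.add_left blinfun.diff_left bounded_linear_Blinfun_apply R')
  have linT: "linear (\<Theta>' x)" for x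
    by (simp add: \<Theta>'_def bounded_linear.linear blinfun.bounded_linear_right)
  have der\<Theta>: "(\<Theta> has_derivative \<Theta>' x) (at x)" if "x \<in> W0" for x
    unfolding \<Theta>_def \<Theta>'_eq[abs_def]
    by (rule derivative_eq_intros bounded_linear.has_derivative[OF R'] der[OF that]
        bounded_linear.has_derivative[OF blinfun.bounded_linear_right] refl)+ simp
  have contT: "continuous_on W0 T"
    unfolding T_def by (intro continuous_intros contDp)
  obtain W V \<Theta>i g' where W: "open W" "W \<subseteq> W1" "xb \<in> W" and V: "open V"
    and hom: "homeomorphism W V \<Theta> \<Theta>i"
    and derV: "\<And>y. y \<in> V \<Longrightarrow> (\<Theta>i has_derivative g' y) (at y)"
      "\<And>y. y \<in> V \<Longrightarrow> g' y = inv (\<Theta>' (\<Theta>i y))"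
    and bijV: "\<And>y. y \<in> V \<Longrightarrow> bij (\<Theta>' (\<Theta>i y))"
  proof (rule inverse_function_theorem[of W1 \<Theta> T xb id_blinfun])
    show "(\<Theta> has_derivative blinfun_apply (T x)) (at x)" if "x \<in> W1" for x
      using der\<Theta>[of x] that W1 by (auto simp: \<Theta>'_def)
    show "continuous_on W1 T" using contT W1(3) by (rule continuous_on_subset)
    show "id_blinfun o\<^sub>L T xb = id_blinfun"
      by (rule blinfun_eqI) (simp add: T_def)
  qed (use W1 in \<open>auto simp: \<Theta>'_def\<close>)
  have WW0: "x \<in> W0" "\<Phi> x \<in> N" if "x \<in> W" for x
    using that W W1 by (auto simp: W1_def)

  define f where "f x = r + lb \<bullet> (\<Phi> x - z)" for x
  define F where "F x = adjoint (blinfun_apply (Dp x)) lb" for x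
  define B' where "B' = (\<lambda>(l, \<sigma>). (adjoint ?A l, \<sigma>)) ` B"
  \<comment> \<open>This is the product rule for
    \<open>\<mu> - adjoint ?A (G \<mu>) + adjoint (Dp x) (lb + G \<mu>)\<close>, the form that the
    subgradient takes once \<open>F\<close> is merged with the adjoint of
    \<open>\<Theta>'\<close>.\<close>
  define P :: "'a \<times> 'a \<Rightarrow> 'a \<times> 'a \<Rightarrow> 'a" where
    "P p = (\<lambda>u. snd u - adjoint ?A (G (snd u)) +
      (adjoint (blinfun_apply (Dp (fst p))) (G (snd u)) +
       adjoint (blinfun_apply (D2 (fst p) (fst u))) (lb + G (snd p))))" for p
  have adjT: "adjoint (\<Theta>' x) \<mu> = \<mu> - adjoint ?A (G \<mu>) + adjoint (blinfun_apply (Dp x)) (G \<mu>)" for x \<mu>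
  proof (rule adjoint_eqI[OF _ linT])
    fix u
    have "R w \<bullet> \<mu> = w \<bullet> G \<mu>" for w
      using adjoint_works[OF R(1), of w \<mu>] R(2) by simp
    then show "\<Theta>' x u \<bullet> \<mu> = u \<bullet> (\<mu> - adjoint ?A (G \<mu>) + adjoint (blinfun_apply (Dp x)) (G \<mu>))"
      by (simp add: \<Theta>'_eq inner_add_left inner_add_right inner_diff_left inner_diff_right adjoint_works[OF linA])
  qed
  have A\<Theta>: "adjoint ?A l \<bullet> \<Theta> x = l \<bullet> (\<Phi> x - z)" if "l \<in> ?L" for l x
  proof -
    have "adjoint ?A l \<bullet> R w = l \<bullet> w" for w
      using adjoint_works[OF R(1), of w "adjoint ?A l"] R(2) G(2)[OF that] by (simp add: inner_commute)
    moreover have "adjoint ?A l \<bullet> w = l \<bullet> ?A w" for w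
      using adjoint_works[OF linA, of w "Dp xb" l] by (simp add: inner_commute)
    ultimately show ?thesis
      by (simp add: \<Theta>_def inner_add_right inner_diff_right blinfun.diff_right)
  qed

  interpret bil: bounded_bilinear "\<lambda>(T :: 'a \<Rightarrow>\<^sub>L 'b) v. adjoint (blinfun_apply T) v"
    by (rule bounded_bilinear_adjoint_blinfun)

  interpret straightened_epigraph \<phi> f F \<Theta> \<Theta>i \<Theta>' W V P B'
  proof
    show "homeomorphism W V \<Theta> \<Theta>i" "open W" "open V" by fact+
    show "continuous_on W (\<lambda>x. \<Theta>' x u)" for u
      unfolding \<Theta>'_def using WW0
      by (intro continuous_intros continuous_on_subset[OF contT]) auto
    show "continuous_on W F"
      unfolding F_def using WW0
      by (intro bil.continuous_on continuous_intros continuous_on_subset[OF contDp]) auto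
    show "continuous_on (W \<times> UNIV) (\<lambda>p. P p w)" for w
      unfolding P_def
      by (intro bil.continuous_on continuous_intros continuous_on_compose2[OF contDp]
          continuous_on_compose2[OF cont2] linear_continuous_on_compose[OF _ G(1)]) (auto simp: WW0)
    show "0 \<le> \<sigma>" if "(b, \<sigma>) \<in> B'" for b \<sigma>
      using that B by (auto simp: B'_def)
    fix x assume x: "x \<in> W"
    show "(\<Theta> has_derivative \<Theta>' x) (at x)" using der\<Theta> WW0 x by blast
    show "bij (\<Theta>' x)"
      using bijV[of "\<Theta> x"] hom x by (auto simp: homeomorphism_def)
    show "(f has_derivative (\<lambda>u. F x \<bullet> u)) (at x)"
      unfolding f_def F_def
      by (rule derivative_eq_intros der WW0 x refl)+
        (simp add: fun_eq_iff adjoint_works[OF linA] inner_commute[of "adjoint _ _"] inner_commute[of lb])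
    show "((\<lambda>p. F (fst p) + adjoint (\<Theta>' (fst p)) (snd p)) has_derivative P (x, \<mu>)) (at (x, \<mu>))" for \<mu>
    proof -
      have eq: "F y + adjoint (\<Theta>' y) \<nu> = \<nu> - adjoint ?A (G \<nu>) + adjoint (blinfun_apply (Dp y)) (lb + G \<nu>)" for y \<nu>
        by (simp add: F_def adjT bil.add_right)
      have dD: "((\<lambda>p. Dp (fst p)) has_derivative (\<lambda>u. D2 x (fst u))) (at (x, \<mu>))"
        by (rule has_derivative_compose_fst) (use der2 WW0 x in simp)
      have dG: "((\<lambda>p :: 'a \<times> 'a. G (snd p)) has_derivative (\<lambda>u. G (snd u))) (at (x, \<mu>))"
        by (intro bounded_linear.has_derivative[OF G'] has_derivative_snd has_derivative_ident)
      have dlG: "((\<lambda>p :: 'a \<times> 'a. lb + G (snd p)) has_derivative (\<lambda>u. G (snd u))) (at (x, \<mu>))"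
        using has_derivative_add[OF has_derivative_const dG] by simp
      show ?thesis
        unfolding eq P_def fst_conv snd_conv
        by (intro has_derivative_add has_derivative_diff has_derivative_snd has_derivative_ident
            bounded_linear.has_derivative[OF bil.bounded_linear_right] dG
            has_derivative_eq_rhs[OF bil.FDERIV[OF dD dlG]]) simp
    qed
    show "P (x, \<mu>) (0, \<nu>) = adjoint (\<Theta>' x) \<nu>" for \<mu> \<nu>
      by (simp add: P_def adjT blinfun.zero_right bil.zero_left)
    show "(x, s) \<in> epi \<phi> \<longleftrightarrow> (\<Theta> x, s - f x) \<in> epi_cone B'" for s
    proof -
      have "(x, s) \<in> epi \<phi> \<longleftrightarrow> (\<Phi> x - z, s - f x) \<in> epi_cone B"
        using loc[OF WW0(2)[OF x], of s] rep[OF WW0(1)[OF x]] by (simp add: mem_epi f_def)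
      also have "\<dots> \<longleftrightarrow> (\<Theta> x, s - f x) \<in> epi_cone B'"
        unfolding epi_cone_def B'_def using A\<Theta> B by fastforce
      finally show ?thesis .
    qed
  next
    show "(\<Theta>i has_derivative inv (\<Theta>' (\<Theta>i y))) (at y)" if "y \<in> V" for y
      using derV[OF that] by simp
  qed

  have "0 \<in> D"
    unfolding D_def dual_section_def
  proof safe
    fix y s assume "(y, s) \<in> epi_cone B'"
    then have "(?A y, s) \<in> epi_cone B"
      using adjoint_works[OF linA, of y "Dp xb"] by (force simp: epi_cone_def B'_def inner_commute)
    from epi_cone_height_nonneg[OF cv gz lb N loc this] have "0 \<le> s" .
    then show "0 \<bullet> y \<le> s" by simp
  qed
  moreover have "\<Theta> xb = 0" "\<Theta>' xb u = u" for u
    using R(1) by (simp_all add: \<Theta>_def \<Theta>'_eq z_def blinfun.zero_right linear_0)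
  ultimately show ?thesis
    using strictly_proto_differentiable_around_iff[of xb] W(3) by (simp add: F_def vb_def)
qed

theorem theorem3p10:
  fixes \<phi> :: "real^'n \<Rightarrow> ereal"
    and \<Phi> :: "real^'n \<Rightarrow> real^'m"
    and g :: "real^'m \<Rightarrow> ereal"
    and xb vb :: "real^'n"
    and lb :: "real^'m"
  assumes "\<bar>\<phi> xb\<bar> \<noteq> \<infinity>"
    and "composite_representation \<phi> g \<Phi> xb"
    and "vb \<in> subdifferential \<phi> xb"
    and "lb \<in> multipliers g \<Phi> xb vb"
    and "SOQC g \<Phi> xb lb"
  shows "(\<exists>U. open U \<and> (xb, vb) \<in> U \<and>
            (\<forall>(x, v) \<in> U \<inter> gph (subdifferential \<phi>).
               strictly_proto_differentiable (subdifferential \<phi>) x v))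
         \<longleftrightarrow> vb \<in> rel_interior (subdifferential \<phi> xb)"
proof -
  from assms(2) obtain W O' Dp D2 where "open W" "xb \<in> W"
    and der: "\<And>x. x \<in> W \<Longrightarrow> (\<Phi> has_derivative blinfun_apply (Dp x)) (at x)"
    and der2: "\<And>x. x \<in> W \<Longrightarrow> (Dp has_derivative blinfun_apply (D2 x)) (at x)"
    and cont2: "continuous_on W D2"
    and "open O'" "xb \<in> O'" and rep: "\<And>x. x \<in> O' \<Longrightarrow> \<phi> x = g (\<Phi> x)"
    and poly: "polyhedron (epi g)"
    unfolding composite_representation_def twice_cont_diff_around_def polyhedral_fun_def by blast
  have "\<Phi> differentiable (at xb)"
    using der[OF \<open>xb \<in> W\<close>] by (auto simp: differentiable_def)
  then have "(\<Phi> has_derivative (\<lambda>h. jacobian \<Phi> (at xb) *v h)) (at xb)"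
    by (simp add: jacobian_works)
  \<comment> \<open>Identifies the abstract derivative with the Jacobian, so that the kernel in SOQC
    becomes the kernel of its adjoint.\<close>
  from has_derivative_unique[OF der[OF \<open>xb \<in> W\<close>] this]
  have adj: "adjoint (blinfun_apply (Dp xb)) l = adjoint_jacobian \<Phi> xb *v l" for l
    by (simp add: adjoint_matrix)
  have lb: "lb \<in> subdifferential g (\<Phi> xb)" "vb = adjoint (blinfun_apply (Dp xb)) lb"
    using assms(4) by (simp_all add: multipliers_def adj)
  have inj: "l = 0" if "l \<in> parallel_subspace (subdifferential g (\<Phi> xb)) lb"
    "adjoint (blinfun_apply (Dp xb)) l = 0" for l
    using parallel_subspace_subset_coderivative[OF polyhedron_imp_convex[OF poly] lb(1)] that
      assms(5) by (auto simp: SOQC_def adj)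
  show ?thesis
    unfolding lb(2)
    by (rule composite_strictly_proto_differentiable_iff[of "W \<inter> O'" xb \<Phi> Dp D2])
      (use \<open>open W\<close> \<open>xb \<in> W\<close> \<open>open O'\<close> \<open>xb \<in> O'\<close> der der2 cont2 rep poly lb(1) inj in
        \<open>auto intro: continuous_on_subset\<close>)
qed

end
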